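(* Let $\mathfrak{n}$ be a (finite-dimensional, real, non-abelian) nilpotent Lie algebra with Lie bracket $[\cdot,\cdot]$, endowed with an inner product $\langle\cdot,\cdot\rangle$, and let $D\in\operatorname{Der}(\mathfrak{n})\cap\operatorname{sym}(\mathfrak{n})$ with $\operatorname{tr} D>0$. Then the following conditions are equivalent: (i) $D$ is Ricci negative. (ii) $D\in\mathbb{R}_{>0}\, m\left(G_D\cdot[\cdot,\cdot]\right)+\operatorname{sym}(\mathfrak{n})_{>0}$. (iii) $D\in\mathbb{R}_{>0}\, m\left(\overline{G_D\cdot[\cdot,\cdot]}\right)+\operatorname{sym}(\mathfrak{n})_{>0}$.
   Context: Derivations: $\operatorname{Der}(\mathfrak{n})$ is the Lie algebra of derivations of $\mathfrak{n}$; $\operatorname{sym}(\mathfrak{n})$ is the space of operators on $\mathfrak{n}$ that are symmetric with respect to $\langle\cdot,\cdot\rangle$, and $\operatorname{sym}(\mathfrak{n})_{>0}$ is the open cone of positive definite ones. Ricci negative derivation: for $D\in\operatorname{Der}(\mathfrak{n})$ let $\mathfrak{s}=\mathbb{R}f\oplus\mathfrak{n}$ be the solvable Lie algebra given by the semidirect sum with $\operatorname{ad} f|_{\mathfrak{n}}=D$. A derivation $D$ with $\operatorname{tr}D>0$ is called Ricci negative if $\mathfrak{s}$ admits an inner product such that $D$ is symmetric with respect to it ($D^t=D$), $f\perp\mathfrak{n}$, and the corresponding left-invariant metric on the simply connected Lie group with Lie algebra $\mathfrak{s}$ has negative definite Ricci curvature. (This inner product on $\mathfrak{s}$ need not restrict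 to the given inner product on $\mathfrak{n}$.) Action: $V=\Lambda^2\mathfrak{n}^*\otimes\mathfrak{n}$ is the space of skew-symmetric bilinear maps $\mathfrak{n}\times\mathfrak{n}\to\mathfrak{n}$, with the $\mathrm{GL}(\mathfrak{n})$-action $g\cdot\mu=g\mu(g^{-1}\cdot,g^{-1}\cdot)$ and derived action $E\cdot\mu=E\mu(\cdot,\cdot)-\mu(E\cdot,\cdot)-\mu(\cdot,E\cdot)$ for $E\in\mathfrak{gl}(\mathfrak{n})$. The bracket $[\cdot,\cdot]$ of $\mathfrak{n}$ is regarded as an element of $V$. $G_D$ is the identity component of the centralizer of $D$ in $\mathrm{GL}(\mathfrak{n})$, and the bar denotes closure in $V$. Moment map: for an orthonormal basis $\{e_i\}$ of $\mathfrak{n}$ with dual basis $\{e^i\}$, give $V$ the inner product making $\{(e^i\wedge e^j)\otimes e_k: i<j\}$ orthonormal (where $(e^i\wedge e^j)\otimes e_k$ is the bilinear map sending $(e_i,e_j)\mapsto e_k$, $(e_j,e_i)\mapsto -e_k$ and all other pairs of basis vectors to $0$), and give $\mathfrak{gl}(\mathfrak{n})$ the inner product $\langle A,B\rangle=\operatorname{tr}AB^t$. The map $m:V\smallsetminus\{0\}\to\operatorname{sym}(\mathfrak{n})$ is defined by $\langle m(\mu),E\rangle=\frac{1}{|\mu|^2}\langle E\cdot\mu,\mu\rangle$ for all $E\in\operatorname{sym}(\mathfrak{n})$. For $S\subset V$, $m(S)$ means $m(S\smallsetminus\{0\})$. For sets, $\mathbb{R}_{>0}A+B=\{ra+b: r>0,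 a\in A, b\in B\}$. *)

theory Defs
  imports "HOL-Analysis.Analysis"
begin

text \<open>
  A finite-dimensional real inner product space is a type of class \<^class>\<open>euclidean_space\<close>; every
  linear endomorphism of it is bounded, so that the space of its operators is \<^typ>\<open>'a \<Rightarrow>\<^sub>L 'a\<close> and
  the space of bilinear maps is \<^typ>\<open>'a \<Rightarrow>\<^sub>L 'a \<Rightarrow>\<^sub>L 'a\<close>, both with the usual topology.
\<close>

definition skew_maps :: "('a::euclidean_space \<Rightarrow>\<^sub>L 'a \<Rightarrow>\<^sub>L 'a) set" where
  "skew_maps = {\<mu> :: 'a \<Rightarrow>\<^sub>L 'a \<Rightarrow>\<^sub>L 'a. \<forall>x y. \<mu> x y = - \<mu> y x}"

definition lie_bracket :: "('a::euclidean_space \<Rightarrow>\<^sub>L 'a \<Rightarrow>\<^sub>L 'a) \<Rightarrow> bool" where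
  "lie_bracket \<mu> \<longleftrightarrow> \<mu> \<in> skew_maps \<and>
     (\<forall>x y z. \<mu> x (\<mu> y z) + \<mu> y (\<mu> z x) + \<mu> z (\<mu> x y) = 0)"

primrec lower_central :: "('a::euclidean_space \<Rightarrow>\<^sub>L 'a \<Rightarrow>\<^sub>L 'a) \<Rightarrow> nat \<Rightarrow> 'a set" where
  "lower_central \<mu> 0 = UNIV"
| "lower_central \<mu> (Suc k) = span {\<mu> x y | x y. y \<in> lower_central \<mu> k}"

definition nilpotent_bracket :: "('a::euclidean_space \<Rightarrow>\<^sub>L 'a \<Rightarrow>\<^sub>L 'a) \<Rightarrow> bool" where
  "nilpotent_bracket \<mu> \<longleftrightarrow> (\<exists>k. lower_central \<mu> k = {0})"

definition Der :: "('a::euclidean_space \<Rightarrow>\<^sub>L 'a \<Rightarrow>\<^sub>L 'a) \<Rightarrow> ('a \<Rightarrow>\<^sub>L 'a) set" where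
  "Der \<mu> = {D :: 'a \<Rightarrow>\<^sub>L 'a. \<forall>x y. D (\<mu> x y) = \<mu> (D x) y + \<mu> x (D y)}"

definition sym_ops :: "('a::euclidean_space \<Rightarrow>\<^sub>L 'a) set" where
  "sym_ops = {A :: 'a \<Rightarrow>\<^sub>L 'a. \<forall>x y. A x \<bullet> y = x \<bullet> A y}"

definition pos_ops :: "('a::euclidean_space \<Rightarrow>\<^sub>L 'a) set" where
  "pos_ops = {A :: 'a \<Rightarrow>\<^sub>L 'a. A \<in> sym_ops \<and> (\<forall>x. x \<noteq> 0 \<longrightarrow> 0 < A x \<bullet> x)}"

text \<open>For linear \<open>A\<close> this does not depend on the basis.\<close>

definition tr :: "('b::euclidean_space \<Rightarrow> 'b) \<Rightarrow> real" where
  "tr A = (\<Sum>b\<in>Basis. A b \<bullet> b)"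

definition inner_product_form :: "('b::euclidean_space \<Rightarrow> 'b \<Rightarrow> real) \<Rightarrow> bool" where
  "inner_product_form ip \<longleftrightarrow> bilinear ip \<and> (\<forall>x y. ip x y = ip y x) \<and> (\<forall>x. x \<noteq> 0 \<longrightarrow> 0 < ip x x)"

text \<open>
  A left-invariant metric on a Lie group is an inner product \<open>ip\<close> on its Lie algebra (with bracket
  \<open>br\<close>).  On left-invariant vector fields \<open>x\<close>, \<open>y\<close> the function \<open>ip x y\<close> is constant and the
  Levi-Civita connection is again left-invariant, so that being torsion-free and metric read as
  follows.  The covariant derivative of \<open>y\<close> in direction \<open>x\<close> is \<open>N x y\<close>.
\<close>

definition is_levi_civita ::
    "('b::euclidean_space \<Rightarrow> 'b \<Rightarrow> 'b) \<Rightarrow> ('b \<Rightarrow> 'b \<Rightarrow> real) \<Rightarrow> ('b \<Rightarrow> 'b \<Rightarrow> 'b) \<Rightarrow> bool" where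
  "is_levi_civita br ip N \<longleftrightarrow> bilinear N \<and>
     (\<forall>x y. N x y - N y x = br x y) \<and>
     (\<forall>x y z. ip (N x y) z + ip y (N x z) = 0)"

definition levi_civita ::
    "('b::euclidean_space \<Rightarrow> 'b \<Rightarrow> 'b) \<Rightarrow> ('b \<Rightarrow> 'b \<Rightarrow> real) \<Rightarrow> 'b \<Rightarrow> 'b \<Rightarrow> 'b" where
  "levi_civita br ip = (THE N. is_levi_civita br ip N)"

definition curvature ::
    "('b::euclidean_space \<Rightarrow> 'b \<Rightarrow> 'b) \<Rightarrow> ('b \<Rightarrow> 'b \<Rightarrow> real) \<Rightarrow> 'b \<Rightarrow> 'b \<Rightarrow> 'b \<Rightarrow> 'b" where
  "curvature br ip x y z = (let N = levi_civita br ip in N x (N y z) - N y (N x z) - N (br x y) z)"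

definition ricci ::
    "('b::euclidean_space \<Rightarrow> 'b \<Rightarrow> 'b) \<Rightarrow> ('b \<Rightarrow> 'b \<Rightarrow> real) \<Rightarrow> 'b \<Rightarrow> 'b \<Rightarrow> real" where
  "ricci br ip x y = tr (\<lambda>z. curvature br ip z x y)"

lemma inner_product_form_riesz:
  fixes ip :: "'b::euclidean_space \<Rightarrow> 'b \<Rightarrow> real"
  assumes ip: "inner_product_form ip" and f: "linear f"
  shows "\<exists>z. \<forall>w. ip z w = f w"
proof -
  have bil: "bilinear ip" and pos: "\<And>x. x \<noteq> 0 \<Longrightarrow> 0 < ip x x"
    using ip by (auto simp: inner_product_form_def)
  have ll: "linear (\<lambda>z. ip z w)" and lr: "linear (ip z)" for z w
    using bil by (auto simp: bilinear_def)
  have lin_expand: "g w = (\<Sum>b\<in>Basis. g b *\<^sub>R b) \<bullet> w" if "linear g" for g :: "'b \<Rightarrow> real" and w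
  proof -
    have "g w = g (\<Sum>b\<in>Basis. (w \<bullet> b) *\<^sub>R b)" by (simp add: euclidean_representation)
    also have "\<dots> = (\<Sum>b\<in>Basis. (w \<bullet> b) * g b)"
      by (simp add: linear_sum[OF that] linear_cmul[OF that])
    finally show ?thesis by (simp add: inner_sum_left inner_commute[of w] mult.commute)
  qed
  define A where "A z = (\<Sum>b\<in>Basis. ip z b *\<^sub>R b)" for z
  have A: "A z \<bullet> w = ip z w" for z w
    unfolding A_def by (rule lin_expand[OF lr, symmetric])
  have "linear A"
    by (rule linearI; rule vector_eq_rdot[THEN iffD1])
       (auto simp: A inner_add_left linear_add[OF ll] linear_cmul[OF ll])
  moreover have "inj A"
  proof (rule linear_injective_0[THEN iffD2, OF \<open>linear A\<close>, rule_format])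
    fix z assume "A z = 0"
    then show "z = 0" using A[of z z] pos[of z] by force
  qed
  ultimately have "surj A" by (rule linear_injective_imp_surjective) (rule refl)
  then obtain z where "A z = (\<Sum>b\<in>Basis. f b *\<^sub>R b)" by (metis surjD)
  then show ?thesis using A lin_expand[OF f] by metis
qed

lemma levi_civita_ex1:
  fixes br :: "'b::euclidean_space \<Rightarrow> 'b \<Rightarrow> 'b"
  assumes ip: "inner_product_form ip" and br: "bilinear br" "\<And>x y. br x y = - br y x"
  shows "\<exists>!N. is_levi_civita br ip N"
proof -
  have bil: "bilinear ip" and ips: "\<And>x y. ip x y = ip y x" and pos: "\<And>x. x \<noteq> 0 \<Longrightarrow> 0 < ip x x"
    using ip by (auto simp: inner_product_form_def)
  note bs = bilinear_ladd[OF bil] bilinear_radd[OF bil] bilinear_lmul[OF bil] bilinear_rmul[OF bil]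
    bilinear_lsub[OF bil] bilinear_rsub[OF bil] bilinear_lneg[OF bil] bilinear_rneg[OF bil]
    bilinear_ladd[OF br(1)] bilinear_radd[OF br(1)] bilinear_lmul[OF br(1)] bilinear_rmul[OF br(1)]
  have ext: "u = v" if "\<And>w. ip u w = ip v w" for u v
    using that[of "u - v"] pos[of "u - v"] by (force simp: bs)
  define k where "k x y w = (ip (br x y) w - ip (br y w) x + ip (br w x) y) / 2" for x y w
  have "linear (k x y)" for x y
    by (rule linearI) (auto simp: k_def bs field_simps)
  then have "\<forall>x y. \<exists>z. \<forall>w. ip z w = k x y w"
    using inner_product_form_riesz[OF ip] by blast
  then obtain N where N: "\<And>x y w. ip (N x y) w = k x y w" by metis
  have "bilinear N"
    unfolding bilinear_def
    by (intro conjI allI; rule linearI; rule ext; simp add: N k_def bs field_simps)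
  moreover have "N x y - N y x = br x y" for x y
  proof (rule ext)
    fix w
    show "ip (N x y - N y x) w = ip (br x y) w"
      using br(2)[of y x] br(2)[of x w] br(2)[of w y] by (simp add: bs N k_def field_simps)
  qed
  moreover have "ip (N x y) z + ip y (N x z) = 0" for x y z
    using br(2)[of y x] br(2)[of x z] br(2)[of z y]
    by (simp add: ips[of y "N x z"] bs N k_def field_simps)
  ultimately have "is_levi_civita br ip N" by (simp add: is_levi_civita_def)
  moreover have "M = N" if "is_levi_civita br ip M" for M
  proof (intro HOL.ext ext)
    fix x y w
    have t: "br u v = M u v - M v u" and m: "ip (M u v) q = - ip (M u q) v" for u v q
      using that unfolding is_levi_civita_def by (simp_all add: eq_neg_iff_add_eq_0 ips[of "M u q" v])
    have "2 * k x y w = 2 * ip (M x y) w"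
      using m[of x y w] m[of y x w] m[of w x y] by (simp add: k_def t bs)
    then show "ip (M x y) w = ip (N x y) w" by (simp add: N)
  qed
  ultimately show ?thesis by blast
qed

text \<open>
  The semidirect sum of \<open>\<real> f\<close> and \<open>(\<nn>, \<mu>)\<close> with \<open>ad f = D\<close> on \<open>\<nn>\<close>: the pair \<open>(a, x)\<close> is \<open>a f + x\<close>.
\<close>

definition semidirect ::
    "('a::euclidean_space \<Rightarrow>\<^sub>L 'a \<Rightarrow>\<^sub>L 'a) \<Rightarrow> ('a \<Rightarrow>\<^sub>L 'a) \<Rightarrow> real \<times> 'a \<Rightarrow> real \<times> 'a \<Rightarrow> real \<times> 'a" where
  "semidirect \<mu> D p q = (0, fst p *\<^sub>R D (snd q) - fst q *\<^sub>R D (snd p) + \<mu> (snd p) (snd q))"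

definition ricci_negative ::
    "('a::euclidean_space \<Rightarrow>\<^sub>L 'a \<Rightarrow>\<^sub>L 'a) \<Rightarrow> ('a \<Rightarrow>\<^sub>L 'a) \<Rightarrow> bool" where
  "ricci_negative \<mu> D \<longleftrightarrow> D \<in> Der \<mu> \<and> 0 < tr D \<and>
     (\<exists>ip. inner_product_form ip \<and>
        (\<forall>x y. ip (0, D x) (0, y) = ip (0, x) (0, D y)) \<and>
        (\<forall>x. ip (1, 0) (0, x) = 0) \<and>
        (\<forall>p. p \<noteq> 0 \<longrightarrow> ricci (semidirect \<mu> D) ip p p < 0))"

definition GL :: "('a::euclidean_space \<Rightarrow>\<^sub>L 'a) set" where
  "GL = {g. bij (blinfun_apply g)}"

definition GL_act ::
    "('a::euclidean_space \<Rightarrow>\<^sub>L 'a) \<Rightarrow> ('a \<Rightarrow>\<^sub>L 'a \<Rightarrow>\<^sub>L 'a) \<Rightarrow> ('a \<Rightarrow>\<^sub>L 'a \<Rightarrow>\<^sub>L 'a)" where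
  "GL_act g \<mu> = Blinfun (\<lambda>x. Blinfun (\<lambda>y. g (\<mu> (inv g x) (inv g y))))"

definition gl_act ::
    "('a::euclidean_space \<Rightarrow>\<^sub>L 'a) \<Rightarrow> ('a \<Rightarrow>\<^sub>L 'a \<Rightarrow>\<^sub>L 'a) \<Rightarrow> ('a \<Rightarrow>\<^sub>L 'a \<Rightarrow>\<^sub>L 'a)" where
  "gl_act E \<mu> = Blinfun (\<lambda>x. Blinfun (\<lambda>y. E (\<mu> x y) - \<mu> (E x) y - \<mu> x (E y)))"

lemma Blinfun2_apply:
  fixes f :: "'a::euclidean_space \<Rightarrow> 'a \<Rightarrow> 'a"
  assumes "bilinear f"
  shows "Blinfun (\<lambda>x. Blinfun (f x)) x y = f x y"
proof -
  have lin: "linear (f x)" "linear (\<lambda>x. f x y)" for x y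
    using assms by (auto simp: bilinear_def)
  have 1: "Blinfun (f x) y = f x y" for x y
    using lin(1) by (simp add: bounded_linear_Blinfun_apply linear_conv_bounded_linear)
  have "linear (\<lambda>x. Blinfun (f x))"
    by (rule linearI; rule blinfun_eqI)
       (simp_all add: 1 blinfun.bilinear_simps linear_add[OF lin(2)] linear_cmul[OF lin(2)])
  then show ?thesis
    by (simp add: bounded_linear_Blinfun_apply linear_conv_bounded_linear 1)
qed

lemma GL_act_apply:
  assumes "g \<in> GL"
  shows "GL_act g \<mu> x y = g (\<mu> (inv g x) (inv g y))"
proof -
  have "linear (inv g)"
  proof (rule linearI)
    have s: "g (inv g x) = x" and i: "inv g (g x) = x" for x
      using assms by (auto simp: GL_def bij_def surj_f_inv_f)
    show "inv g (x + y) = inv g x + inv g y" for x y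
      by (metis s i blinfun.add_right)
    show "inv g (c *\<^sub>R x) = c *\<^sub>R inv g x" for c x
      by (metis s i blinfun.scaleR_right)
  qed
  then have "bilinear (\<lambda>x y. g (\<mu> (inv g x) (inv g y)))"
    by (auto simp: bilinear_def linear_iff blinfun.bilinear_simps)
  then show ?thesis by (simp add: GL_act_def Blinfun2_apply)
qed

lemma gl_act_apply: "gl_act E \<mu> x y = E (\<mu> x y) - \<mu> (E x) y - \<mu> x (E y)"
proof -
  have "bilinear (\<lambda>x y. E (\<mu> x y) - \<mu> (E x) y - \<mu> x (E y))"
    by (auto simp: bilinear_def linear_iff blinfun.bilinear_simps algebra_simps)
  then show ?thesis by (simp add: gl_act_def Blinfun2_apply)
qed

definition centralizer_comp :: "('a::euclidean_space \<Rightarrow>\<^sub>L 'a) \<Rightarrow> ('a \<Rightarrow>\<^sub>L 'a) set" where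
  "centralizer_comp D = connected_component_set {g \<in> GL. g o\<^sub>L D = D o\<^sub>L g} id_blinfun"

definition centralizer_orbit ::
    "('a::euclidean_space \<Rightarrow>\<^sub>L 'a) \<Rightarrow> ('a \<Rightarrow>\<^sub>L 'a \<Rightarrow>\<^sub>L 'a) \<Rightarrow> ('a \<Rightarrow>\<^sub>L 'a \<Rightarrow>\<^sub>L 'a) set" where
  "centralizer_orbit D \<mu> = (\<lambda>g. GL_act g \<mu>) ` centralizer_comp D"

text \<open>
  Since the space of skew-symmetric maps is closed, the closure of a subset of it is the same
  whether it is taken there or in the space of all bilinear maps.
\<close>

lemma closed_skew_maps: "closed (skew_maps :: ('a::euclidean_space \<Rightarrow>\<^sub>L 'a \<Rightarrow>\<^sub>L 'a) set)"
  unfolding skew_maps_def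
  by (intro closed_Collect_all closed_Collect_eq continuous_intros)

lemma centralizer_orbit_skew:
  assumes "\<mu> \<in> skew_maps"
  shows "centralizer_orbit D \<mu> \<subseteq> skew_maps"
proof -
  have sk: "\<mu> x y = - \<mu> y x" for x y
    using assms unfolding skew_maps_def by blast
  have "g (\<mu> x y) = - g (\<mu> y x)" for g :: "'a \<Rightarrow>\<^sub>L 'a" and x y
    by (subst sk) (rule blinfun.minus_right)
  then have "GL_act g \<mu> \<in> skew_maps" if "g \<in> GL" for g
    unfolding skew_maps_def mem_Collect_eq GL_act_apply[OF that] by blast
  moreover have "centralizer_comp D \<subseteq> GL"
    unfolding centralizer_comp_def
    by (rule subset_trans[OF connected_component_subset]) auto
  ultimately show ?thesis by (auto simp: centralizer_orbit_def)
qed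

text \<open>
  The coefficient of \<open>\<mu>\<close> at \<open>(e\<^sup>i \<and> e\<^sup>j) \<otimes> e\<^sub>k\<close> is \<open>\<mu> e\<^sub>i e\<^sub>j \<bullet> e\<^sub>k\<close>, and the inner product making these
  maps orthonormal for \<open>i < j\<close> sums products of coefficients over \<open>i < j\<close> only; summing over all
  \<open>i\<close>, \<open>j\<close> counts everything twice.
\<close>

definition skew_inner ::
    "('a::euclidean_space \<Rightarrow>\<^sub>L 'a \<Rightarrow>\<^sub>L 'a) \<Rightarrow> ('a \<Rightarrow>\<^sub>L 'a \<Rightarrow>\<^sub>L 'a) \<Rightarrow> real" where
  "skew_inner \<mu> \<nu> = (\<Sum>i\<in>Basis. \<Sum>j\<in>Basis. \<Sum>k\<in>Basis. (\<mu> i j \<bullet> k) * (\<nu> i j \<bullet> k)) / 2"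

definition gl_inner :: "('a::euclidean_space \<Rightarrow>\<^sub>L 'a) \<Rightarrow> ('a \<Rightarrow>\<^sub>L 'a) \<Rightarrow> real" where
  "gl_inner A B = tr (\<lambda>x. A (adjoint B x))"

definition is_moment :: "('a::euclidean_space \<Rightarrow>\<^sub>L 'a \<Rightarrow>\<^sub>L 'a) \<Rightarrow> ('a \<Rightarrow>\<^sub>L 'a) \<Rightarrow> bool" where
  "is_moment \<mu> M \<longleftrightarrow> M \<in> sym_ops \<and>
     (\<forall>E\<in>sym_ops. gl_inner M E = 1 / skew_inner \<mu> \<mu> * skew_inner (gl_act E \<mu>) \<mu>)"

definition moment :: "('a::euclidean_space \<Rightarrow>\<^sub>L 'a \<Rightarrow>\<^sub>L 'a) \<Rightarrow> ('a \<Rightarrow>\<^sub>L 'a)" where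
  "moment \<mu> = (THE M. is_moment \<mu> M)"

definition moment_image :: "('a::euclidean_space \<Rightarrow>\<^sub>L 'a \<Rightarrow>\<^sub>L 'a) set \<Rightarrow> ('a \<Rightarrow>\<^sub>L 'a) set" where
  "moment_image S = moment ` (S - {0})"

lemma gl_inner_Basis: "gl_inner A B = (\<Sum>j\<in>Basis. A j \<bullet> B j)"
proof -
  have lB: "linear (blinfun_apply B)" by (intro bounded_linear.linear blinfun.bounded_linear_right)
  have "A (adjoint B b) \<bullet> b = (\<Sum>j\<in>Basis. (A j \<bullet> b) * (B j \<bullet> b))" for b
  proof -
    have "adjoint B b = (\<Sum>j\<in>Basis. (B j \<bullet> b) *\<^sub>R j)"
      using euclidean_representation[of "adjoint B b"]
      by (simp add: adjoint_clauses[OF lB] inner_commute[of b])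
    then show ?thesis
      by (simp add: blinfun.sum_right blinfun.scaleR_right inner_sum_left mult.commute)
  qed
  then have "gl_inner A B = (\<Sum>b\<in>Basis. \<Sum>j\<in>Basis. (A j \<bullet> b) * (B j \<bullet> b))"
    by (simp add: gl_inner_def tr_def)
  also have "\<dots> = (\<Sum>j\<in>Basis. \<Sum>b\<in>Basis. (A j \<bullet> b) * (B j \<bullet> b))" by (rule sum.swap)
  also have "\<dots> = (\<Sum>j\<in>Basis. A j \<bullet> B j)"
    by (intro sum.cong refl euclidean_inner[symmetric])
  finally show ?thesis .
qed

lemma moment_ex1: "\<exists>!M. is_moment \<mu> M"
proof -
  define f where "f E = 1 / skew_inner \<mu> \<mu> * skew_inner (gl_act E \<mu>) \<mu>" for E
  have skl: "linear (\<lambda>\<nu>. skew_inner \<nu> \<mu>)"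
    by (rule linearI)
       (simp_all add: skew_inner_def blinfun.bilinear_simps inner_add_left algebra_simps
          sum.distrib sum_distrib_left add_divide_distrib)
  have "gl_act (E + F) \<mu> = gl_act E \<mu> + gl_act F \<mu>" "gl_act (c *\<^sub>R E) \<mu> = c *\<^sub>R gl_act E \<mu>" for E F c
    by (intro blinfun_eqI; simp add: gl_act_apply blinfun.bilinear_simps algebra_simps)+
  then have "linear f"
    by (intro linearI) (simp_all add: f_def linear_add[OF skl] linear_cmul[OF skl] algebra_simps)
  define e :: "'a \<Rightarrow> 'a \<Rightarrow> 'a \<Rightarrow>\<^sub>L 'a"
    where "e i j = blinfun_scaleR_left i o\<^sub>L blinfun_inner_left j" for i j
  have e: "e i j x = (x \<bullet> j) *\<^sub>R i" for i j x
    by (simp add: e_def inner_commute)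
  define M where "M = blinfun_of_matrix (\<lambda>i j. f ((1/2) *\<^sub>R (e i j + e j i)))"
  have M: "M j \<bullet> i = f ((1/2) *\<^sub>R (e i j + e j i))" if "i \<in> Basis" "j \<in> Basis" for i j
    using that unfolding M_def
    by (simp add: blinfun_of_matrix_apply inner_sum_left inner_Basis if_distrib if_distribR
          sum.delta' cong: if_cong)
  have "M \<in> sym_ops"
    unfolding sym_ops_def
  proof clarify
    fix x y
    have Mx: "M x \<bullet> y = (\<Sum>i\<in>Basis. \<Sum>j\<in>Basis. (x \<bullet> i) * (y \<bullet> j) * (M i \<bullet> j))" for x y
    proof -
      have "M x = (\<Sum>i\<in>Basis. (x \<bullet> i) *\<^sub>R M i)"
        using arg_cong[OF euclidean_representation[of x], of M]
        by (simp add: blinfun.sum_right blinfun.scaleR_right)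
      then have "M x \<bullet> y = (\<Sum>i\<in>Basis. (x \<bullet> i) * (M i \<bullet> y))"
        by (simp add: inner_sum_left)
      also have "\<dots> = (\<Sum>i\<in>Basis. (x \<bullet> i) * (\<Sum>j\<in>Basis. (M i \<bullet> j) * (y \<bullet> j)))"
        by (intro sum.cong refl arg_cong2[where f = "(*)"] euclidean_inner)
      finally show ?thesis
        by (simp add: sum_distrib_left mult_ac)
    qed
    have "M y \<bullet> x = (\<Sum>j\<in>Basis. \<Sum>i\<in>Basis. (y \<bullet> i) * (x \<bullet> j) * (M i \<bullet> j))"
      unfolding Mx[of y x] by (rule sum.swap)
    also have "\<dots> = M x \<bullet> y"
      unfolding Mx[of x y] by (intro sum.cong refl) (simp add: M add.commute mult_ac)
    finally show "M x \<bullet> y = x \<bullet> M y" by (simp add: inner_commute)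
  qed
  moreover have "gl_inner M E = f E" if "E \<in> sym_ops" for E
  proof -
    have sE: "E i \<bullet> j = E j \<bullet> i" for i j
      using that by (metis (mono_tags, lifting) sym_ops_def mem_Collect_eq inner_commute)
    have "gl_inner M E = (\<Sum>j\<in>Basis. \<Sum>i\<in>Basis. (E j \<bullet> i) * (M j \<bullet> i))"
      unfolding gl_inner_Basis by (intro sum.cong refl) (subst euclidean_inner, simp add: mult.commute)
    also have "\<dots> = (\<Sum>j\<in>Basis. \<Sum>i\<in>Basis. (E j \<bullet> i) * f ((1/2) *\<^sub>R (e i j + e j i)))"
      by (intro sum.cong refl) (simp add: M)
    also have "\<dots> = f (\<Sum>j\<in>Basis. \<Sum>i\<in>Basis. (E j \<bullet> i) *\<^sub>R ((1/2) *\<^sub>R (e i j + e j i)))"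
      by (simp only: linear_sum[OF \<open>linear f\<close>] linear_cmul[OF \<open>linear f\<close>] real_scaleR_def)
    also have "(\<Sum>j\<in>Basis. \<Sum>i\<in>Basis. (E j \<bullet> i) *\<^sub>R ((1/2) *\<^sub>R (e i j + e j i))) = E" (is "?S = E")
    proof -
      have a: "(\<Sum>j\<in>Basis. \<Sum>i\<in>Basis. (E j \<bullet> i) *\<^sub>R e i j) = E"
      proof (rule blinfun_eqI)
        fix x
        have "(\<Sum>j\<in>Basis. \<Sum>i\<in>Basis. (E j \<bullet> i) *\<^sub>R e i j) x
            = (\<Sum>j\<in>Basis. (x \<bullet> j) *\<^sub>R (\<Sum>i\<in>Basis. (E j \<bullet> i) *\<^sub>R i))"
          by (simp add: blinfun.sum_left blinfun.scaleR_left e scaleR_sum_right mult.commute)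
        also have "\<dots> = E x"
        proof -
          have "E x = E (\<Sum>j\<in>Basis. (x \<bullet> j) *\<^sub>R j)" by (simp only: euclidean_representation)
          also have "\<dots> = (\<Sum>j\<in>Basis. (x \<bullet> j) *\<^sub>R E j)"
            by (simp only: blinfun.sum_right blinfun.scaleR_right)
          finally show ?thesis by (simp only: euclidean_representation)
        qed
        finally show "(\<Sum>j\<in>Basis. \<Sum>i\<in>Basis. (E j \<bullet> i) *\<^sub>R e i j) x = E x" .
      qed
      have "(\<Sum>j\<in>Basis. \<Sum>i\<in>Basis. (E j \<bullet> i) *\<^sub>R e j i) = (\<Sum>i\<in>Basis. \<Sum>j\<in>Basis. (E j \<bullet> i) *\<^sub>R e j i)"
        by (rule sum.swap)
      also have "\<dots> = E" using a by (simp add: sE)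
      finally have b: "(\<Sum>j\<in>Basis. \<Sum>i\<in>Basis. (E j \<bullet> i) *\<^sub>R e j i) = E" .
      have "?S = (1/2) *\<^sub>R ((\<Sum>j\<in>Basis. \<Sum>i\<in>Basis. (E j \<bullet> i) *\<^sub>R e i j)
          + (\<Sum>j\<in>Basis. \<Sum>i\<in>Basis. (E j \<bullet> i) *\<^sub>R e j i))"
        by (simp add: scaleR_sum_right scaleR_right_distrib sum.distrib mult.commute)
      also have "\<dots> = E" by (simp only: a b) (simp add: scaleR_2[symmetric])
      finally show ?thesis .
    qed
    finally show ?thesis .
  qed
  ultimately have "is_moment \<mu> M" by (simp add: is_moment_def f_def)
  moreover have "M1 = M2" if 1: "is_moment \<mu> M1" and 2: "is_moment \<mu> M2" for M1 M2
  proof -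
    have "M1 - M2 \<in> sym_ops"
      using 1 2 by (auto simp: is_moment_def sym_ops_def blinfun.diff_left inner_diff)
    then have "gl_inner M1 (M1 - M2) = gl_inner M2 (M1 - M2)"
      using 1 2 by (simp add: is_moment_def)
    then have "(\<Sum>j\<in>Basis. (M1 - M2) j \<bullet> (M1 - M2) j) = 0"
      by (simp add: gl_inner_Basis blinfun.diff_left[of M1 M2] inner_diff_left sum_subtractf)
    then have "(M1 - M2) j = 0" if "j \<in> Basis" for j
      using that by (subst (asm) sum_nonneg_eq_0_iff) auto
    then have "M1 - M2 = 0"
      by (intro blinfun_euclidean_eqI) simp
    then show ?thesis by simp
  qed
  ultimately show ?thesis by blast
qed

definition ray_sum :: "'c::real_vector set \<Rightarrow> 'c set \<Rightarrow> 'c set" where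
  "ray_sum A B = {r *\<^sub>R a + b | r a b. 0 < r \<and> a \<in> A \<and> b \<in> B}"

end

theory Submission
  imports Defs
begin

text \<open>
  An inner product on \<open>\<real> f \<oplus> \<nn>\<close> with \<open>f \<perp> \<nn>\<close> for which \<open>D\<close> is symmetric has the form
  \<open>c a b + \<langle>g x, g y\<rangle>\<close> with \<open>g\<close> a square root commuting with \<open>D\<close>, so that \<open>g\<close> can be taken in
  \<open>G\<^sub>D\<close>.  Carried over by \<open>g\<close> to the given inner product, its Ricci form at \<open>a f + x\<close> becomes
  \<open>Ric\<^sub>\<nu> x - (tr D / c) \<langle>D x, x\<rangle> - a\<^sup>2 tr D\<^sup>2\<close> with \<open>\<nu> = g \<cdot> [\<cdot>,\<cdot>]\<close> and
  \<open>Ric\<^sub>\<nu> x = \<bar>\<nu>\<bar>\<^sup>2 / 2 * \<langle>m(\<nu>) x, x\<rangle>\<close>; the Killing form and the mixed terms vanish because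
  the operators involved lower the central series.  So (i) says that \<open>D - r m(\<nu>)\<close> is positive
  definite for some \<open>r > 0\<close> and some \<open>\<nu>\<close> in the orbit, which is (ii).  This is an open condition
  on \<open>\<nu>\<close>, hence (iii) implies (ii).
\<close>

subsection \<open>Traces and the lower central series\<close>

lemma linear_blinfun_apply: "linear (blinfun_apply A)"
  by (intro bounded_linear.linear blinfun.bounded_linear_right)

lemma linear_eq_inner_sum_Basis:
  fixes f :: "'b::euclidean_space \<Rightarrow> real"
  assumes "linear f"
  shows "(\<Sum>b\<in>Basis. f b *\<^sub>R b) \<bullet> w = f w"
proof -
  have "f w = f (\<Sum>b\<in>Basis. (w \<bullet> b) *\<^sub>R b)" by (simp add: euclidean_representation)
  also have "\<dots> = (\<Sum>b\<in>Basis. (w \<bullet> b) * f b)"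
    by (simp add: linear_sum[OF assms] linear_cmul[OF assms])
  finally show ?thesis by (simp add: inner_sum_left inner_commute[of w] mult.commute)
qed

lemma tr_add: "tr (\<lambda>x. A x + B x) = tr A + tr B"
  by (simp add: tr_def inner_add_left sum.distrib)

lemma tr_cmul: "tr (\<lambda>x. c *\<^sub>R A x) = c * tr A"
  by (simp add: tr_def sum_distrib_left)

lemma tr_comp_commute:
  fixes A :: "'b::euclidean_space \<Rightarrow> 'c::euclidean_space"
  assumes A: "linear A" and B: "linear B"
  shows "tr (\<lambda>x. A (B x)) = tr (\<lambda>x. B (A x))"
proof -
  have *: "tr (\<lambda>x. F (G x)) = (\<Sum>c\<in>Basis. \<Sum>b\<in>Basis. (G c \<bullet> b) * (F b \<bullet> c))"
    if F: "linear F" for F :: "'d::euclidean_space \<Rightarrow> 'e::euclidean_space" and G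
  proof -
    have "F (G c) \<bullet> c = (\<Sum>b\<in>Basis. (G c \<bullet> b) * (F b \<bullet> c))" for c
    proof -
      have "F (G c) = F (\<Sum>b\<in>Basis. (G c \<bullet> b) *\<^sub>R b)" by (simp add: euclidean_representation)
      then show ?thesis by (simp add: linear_sum[OF F] linear_cmul[OF F] inner_sum_left)
    qed
    then show ?thesis by (simp add: tr_def)
  qed
  show ?thesis
    unfolding *[OF A] *[OF B] by (subst sum.swap) (simp add: mult.commute)
qed

lemma tr_conjugate:
  fixes T :: "'b::euclidean_space \<Rightarrow> 'c::euclidean_space"
  assumes "linear T" "linear S" "linear A" "\<And>x. T (S x) = x"
  shows "tr (\<lambda>x. S (A (T x))) = tr A"
  using tr_comp_commute[of S "\<lambda>x. A (T x)"] linear_compose[OF assms(1,3)] assms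
  by (simp add: o_def)

text \<open>
  For projections \<open>p\<^sub>k\<close> onto \<open>C k\<close> one has \<open>tr (p\<^sub>k A) = tr (p\<^sub>k A p\<^sub>k) = tr (p\<^sub>k\<^sub>+\<^sub>1 A p\<^sub>k) = tr (p\<^sub>k\<^sub>+\<^sub>1 A)\<close>.
\<close>

lemma tr_eq_0_if_lowers_filtration:
  fixes C :: "nat \<Rightarrow> 'b::euclidean_space set"
  assumes A: "linear A" and sub: "\<And>k. subspace (C k)" and dec: "\<And>k. C (Suc k) \<subseteq> C k"
    and top: "C 0 = UNIV" and bot: "C K = {0}" and low: "\<And>k x. x \<in> C k \<Longrightarrow> A x \<in> C (Suc k)"
  shows "tr A = 0"
proof -
  have "\<exists>p. linear p \<and> range p \<subseteq> C k \<and> (\<forall>x\<in>C k. p x = x)" for k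
    using linear_exists_left_inverse_on[OF linear_id sub[of k]] by (auto simp: id_def)
  then obtain p where p: "\<And>k. linear (p k)" "\<And>k x. p k x \<in> C k" "\<And>k x. x \<in> C k \<Longrightarrow> p k x = x"
    by (metis UNIV_I image_subset_iff)
  have Ap: "linear (\<lambda>x. A (p k x))" "linear (\<lambda>x. p k (A x))" for k
    using linear_compose[OF p(1) A] linear_compose[OF A p(1)] by (simp_all add: o_def)
  have "tr (\<lambda>x. p k (A x)) = tr A" for k
  proof (induction k)
    case 0
    then show ?case using p(3)[of _ 0] top by simp
  next
    case (Suc k)
    have d: "C (Suc k) \<subseteq> C k" by (rule dec)
    have "tr (\<lambda>x. p (Suc k) (A x)) = tr (\<lambda>x. p k (p (Suc k) (A x)))"
      using p(2)[of "Suc k"] p(3)[of _ k] d by (simp add: subset_iff)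
    also have "\<dots> = tr (\<lambda>x. p (Suc k) (A (p k x)))"
      by (rule tr_comp_commute[OF p(1) Ap(2)])
    also have "\<dots> = tr (\<lambda>x. p k (A (p k x)))"
    proof -
      have "p (Suc k) (A (p k x)) = p k (A (p k x))" for x
        using low[OF p(2)[of k x]] d p(3) by (metis subsetD)
      then show ?thesis by simp
    qed
    also have "\<dots> = tr (\<lambda>x. p k (p k (A x)))"
      by (rule tr_comp_commute[OF p(1) Ap(2), symmetric])
    also have "\<dots> = tr (\<lambda>x. p k (A x))" using p(2,3) by simp
    finally show ?case using Suc by simp
  qed
  from this[of K] have "tr A = tr (\<lambda>x. p K (A x))" by simp
  also have "\<dots> = 0" using p(2)[of K] bot by (simp add: tr_def)
  finally show ?thesis .
qed

lemma subspace_lower_central: "subspace (lower_central \<mu> k)"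
  by (cases k) (auto simp: subspace_span)

lemma bracket_in_lower_central_Suc:
  "y \<in> lower_central \<mu> k \<Longrightarrow> \<mu> x y \<in> lower_central \<mu> (Suc k)"
  by (auto intro: span_base)

lemma lower_central_Suc_subset: "lower_central \<mu> (Suc k) \<subseteq> lower_central \<mu> k"
proof (induction k)
  case (Suc k)
  have "{\<mu> x y |x y. y \<in> lower_central \<mu> (Suc k)} \<subseteq> lower_central \<mu> (Suc k)"
    using Suc bracket_in_lower_central_Suc by blast
  then have "span {\<mu> x y |x y. y \<in> lower_central \<mu> (Suc k)} \<subseteq> lower_central \<mu> (Suc k)"
    by (rule span_minimal[OF _ subspace_lower_central])
  then show ?case by (subst lower_central.simps(2))
qed simp

text \<open>Induction on the depth: on a generator \<open>\<mu> u v\<close> the Leibniz rule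
  produces one bracket with \<open>v\<close> and one with \<open>D v\<close>, and both second
  arguments lie in the previous term of the series.\<close>

lemma derivation_lower_central:
  assumes "D \<in> Der \<mu>" "x \<in> lower_central \<mu> k"
  shows "D x \<in> lower_central \<mu> k"
  using assms(2)
proof (induction k arbitrary: x)
  case (Suc k)
  let ?L = "lower_central \<mu> (Suc k)"
  have "subspace {x. D x \<in> ?L}"
    by (rule linear_subspace_linear_preimage[OF linear_blinfun_apply subspace_lower_central])
  moreover have "{\<mu> u v |u v. v \<in> lower_central \<mu> k} \<subseteq> {x. D x \<in> ?L}"
  proof clarify
    fix u v assume v: "v \<in> lower_central \<mu> k"
    have "D (\<mu> u v) = \<mu> (D u) v + \<mu> u (D v)" using assms(1) by (simp add: Der_def)
    then show "D (\<mu> u v) \<in> ?L"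
      by (simp only: subspace_add[OF subspace_lower_central]
          bracket_in_lower_central_Suc[OF v] bracket_in_lower_central_Suc[OF Suc.IH[OF v]])
  qed
  ultimately have "span {\<mu> u v |u v. v \<in> lower_central \<mu> k} \<subseteq> {x. D x \<in> ?L}"
    by (intro span_minimal)
  then show ?case using Suc.prems by auto
qed simp

text \<open>Bracketing with \<open>x\<close> moves each term of the lower central series into the
  next one and \<open>D\<close> preserves every term, so all three operators lower this filtration.
  The vanishing traces stand for unimodularity, the Killing form and the terms that mix
  \<open>f\<close> with the nilradical part in the Ricci form.\<close>

lemma tr_bracket_operators:
  assumes "nilpotent_bracket \<mu>"
  shows "tr (\<mu> x) = 0" "tr (\<lambda>y. \<mu> x (\<mu> x y)) = 0"
    and "D \<in> Der \<mu> \<Longrightarrow> tr (\<lambda>y. D (\<mu> x y)) = 0"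
proof -
  obtain K where K: "lower_central \<mu> K = {0}"
    using assms by (auto simp: nilpotent_bracket_def)
  note lin = linear_blinfun_apply linear_compose[OF linear_blinfun_apply linear_blinfun_apply, unfolded o_def]
  note z = tr_eq_0_if_lowers_filtration[where C = "lower_central \<mu>" and K = K,
      OF _ subspace_lower_central lower_central_Suc_subset lower_central.simps(1) K]
  show "tr (\<mu> x) = 0"
    by (rule z[OF lin(1) bracket_in_lower_central_Suc])
  show "tr (\<lambda>y. \<mu> x (\<mu> x y)) = 0"
    by (rule z[OF lin(2)]) (meson bracket_in_lower_central_Suc lower_central_Suc_subset subsetD)
  show "tr (\<lambda>y. D (\<mu> x y)) = 0" if "D \<in> Der \<mu>"
    by (rule z[OF lin(2)]) (metis bracket_in_lower_central_Suc derivation_lower_central that)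
qed

subsection \<open>The Ricci form and the moment map\<close>

lemma tr_diff: "tr (\<lambda>x. A x - B x) = tr A - tr B"
  by (simp add: tr_def inner_diff_left sum_subtractf)

lemma tr_prod_real:
  fixes A :: "real \<times> 'a::euclidean_space \<Rightarrow> real \<times> 'a"
  shows "tr A = fst (A (1, 0)) + tr (\<lambda>e. snd (A (0, e)))"
proof -
  have f: "(Basis :: (real \<times> 'a) set) = insert (1, 0) (Pair 0 ` Basis)"
    by (auto simp: Basis_prod_def)
  moreover have "inj_on (Pair (0::real)) (Basis :: 'a set)" by (auto intro: inj_onI)
  ultimately have "(\<Sum>b\<in>Basis. A b \<bullet> b) = A (1, 0) \<bullet> (1, 0) + (\<Sum>e\<in>Basis. A (0, e) \<bullet> (0, e))"
    by (subst f, subst sum.insert) (auto simp: sum.reindex)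
  then show ?thesis by (simp add: tr_def inner_prod_def)
qed

lemma skew_mapsD: "\<mu> \<in> skew_maps \<Longrightarrow> \<mu> x y = - \<mu> y x"
  unfolding skew_maps_def by blast

text \<open>This is the contraction of a skew tensor with a symmetric one: exchanging the two
  summation indices turns the sum into its negative.\<close>

lemma sum_skew_sym_eq_0:
  assumes sk: "\<mu> \<in> skew_maps" and E: "E \<in> sym_ops"
  shows "(\<Sum>e\<in>Basis. \<mu> e (E e)) = (0::'a::euclidean_space)"
proof -
  let ?s = "\<Sum>e\<in>Basis. \<mu> e (E e)"
  have "\<mu> e (E e) = (\<Sum>j\<in>Basis. (E e \<bullet> j) *\<^sub>R \<mu> e j)" for e
  proof -
    have "\<mu> e (E e) = \<mu> e (\<Sum>j\<in>Basis. (E e \<bullet> j) *\<^sub>R j)" by (simp add: euclidean_representation)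
    then show ?thesis by (simp add: blinfun.sum_right blinfun.scaleR_right)
  qed
  then have s: "?s = (\<Sum>e\<in>Basis. \<Sum>j\<in>Basis. (E e \<bullet> j) *\<^sub>R \<mu> e j)" by simp
  also have "\<dots> = (\<Sum>j\<in>Basis. \<Sum>e\<in>Basis. (E e \<bullet> j) *\<^sub>R \<mu> e j)" by (rule sum.swap)
  also have "\<dots> = (\<Sum>j\<in>Basis. \<Sum>e\<in>Basis. - ((E j \<bullet> e) *\<^sub>R \<mu> j e))"
  proof (intro sum.cong refl)
    fix j e
    have "E e \<bullet> j = E j \<bullet> e" using E by (simp add: sym_ops_def inner_commute)
    moreover have "\<mu> e j = - \<mu> j e" by (rule skew_mapsD[OF sk])
    ultimately show "(E e \<bullet> j) *\<^sub>R \<mu> e j = - ((E j \<bullet> e) *\<^sub>R \<mu> j e)" by simp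
  qed
  also have "\<dots> = - ?s" unfolding s by (simp add: sum_negf)
  finally have "2 *\<^sub>R ?s = 0" by (simp only: scaleR_2 eq_neg_iff_add_eq_0)
  then show ?thesis by simp
qed

text \<open>The Levi-Civita connection of the standard inner product, given by the Koszul formula.
  Reading off its coordinates in \<open>Basis\<close> gives an explicit vector instead of a definite
  description.\<close>

definition koszul :: "('a::euclidean_space \<Rightarrow>\<^sub>L 'a \<Rightarrow>\<^sub>L 'a) \<Rightarrow> 'a \<Rightarrow> 'a \<Rightarrow> 'a" where
  "koszul \<mu> x y = (\<Sum>w\<in>Basis. ((\<mu> x y \<bullet> w - \<mu> y w \<bullet> x + \<mu> w x \<bullet> y) / 2) *\<^sub>R w)"

lemma koszul_inner: "koszul \<mu> x y \<bullet> z = (\<mu> x y \<bullet> z - \<mu> y z \<bullet> x + \<mu> z x \<bullet> y) / 2"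
  unfolding koszul_def
  by (rule linear_eq_inner_sum_Basis, rule linearI)
     (simp_all add: blinfun.bilinear_simps inner_add algebra_simps add_divide_distrib diff_divide_distrib)

lemma bilinear_koszul: "bilinear (koszul \<mu>)"
  unfolding bilinear_def
  by (intro conjI allI; rule linearI; rule vector_eq_rdot[THEN iffD1])
     (auto simp: koszul_inner blinfun.bilinear_simps inner_add algebra_simps add_divide_distrib diff_divide_distrib)

text \<open>The classical formula for the Ricci quadratic form of a nilpotent Lie algebra with an
  inner product. The factor 1/4 goes with summing over all ordered pairs of basis vectors.\<close>

definition ric_form :: "('a::euclidean_space \<Rightarrow>\<^sub>L 'a \<Rightarrow>\<^sub>L 'a) \<Rightarrow> 'a \<Rightarrow> real" where
  "ric_form \<mu> x = (\<Sum>i\<in>Basis. \<Sum>j\<in>Basis. (\<mu> i j \<bullet> x)\<^sup>2) / 4 - (\<Sum>i\<in>Basis. \<mu> x i \<bullet> \<mu> x i) / 2"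

lemma skew_maps_self: "\<mu> \<in> skew_maps \<Longrightarrow> \<mu> x x = 0"
  using skew_mapsD[of \<mu> x x] by (simp add: eq_neg_iff_add_eq_0 scaleR_2[symmetric])

text \<open>On the diagonal the Koszul formula collapses to
  \<open>- (\<mu> y e \<bullet> e)\<close>, so the trace is minus that of
  \<open>\<mu> y\<close>.\<close>

lemma tr_koszul_left:
  assumes sk: "\<mu> \<in> skew_maps" and uni: "tr (\<mu> y) = 0"
  shows "tr (\<lambda>z. koszul \<mu> z y) = 0"
proof -
  have "koszul \<mu> e y \<bullet> e = - (\<mu> y e \<bullet> e)" for e
    using skew_mapsD[OF sk, of e y] skew_maps_self[OF sk, of e] by (simp add: koszul_inner)
  then show ?thesis using uni by (simp add: tr_def sum_negf)
qed

lemma koszul_skew: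
  assumes sk: "\<mu> \<in> skew_maps"
  shows "koszul \<mu> x y \<bullet> z = - (koszul \<mu> x z \<bullet> y)"
  using skew_mapsD[OF sk, of x y] skew_mapsD[OF sk, of x z] skew_mapsD[OF sk, of y z]
  by (simp add: koszul_inner field_simps)

lemma koszul_torsion:
  assumes sk: "\<mu> \<in> skew_maps"
  shows "koszul \<mu> x y - koszul \<mu> y x = \<mu> x y"
proof (rule vector_eq_rdot[THEN iffD1], rule allI)
  fix z
  show "(koszul \<mu> x y - koszul \<mu> y x) \<bullet> z = \<mu> x y \<bullet> z"
    using skew_mapsD[OF sk, of y x] skew_mapsD[OF sk, of x z] skew_mapsD[OF sk, of z y]
    by (simp add: koszul_inner inner_diff_left field_simps)
qed

text \<open>The Ricci form in direction \<open>x\<close>, with the three curvature terms traced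
  separately. The first vanishes by unimodularity; in the other two the products of \<alpha> and
  \<gamma> cancel and the Killing form drops out by \<open>kill\<close>, which leaves only the
  squares of \<open>ric_form\<close>.\<close>

lemma tr_koszul_curvature:
  fixes \<mu> :: "'a::euclidean_space \<Rightarrow>\<^sub>L 'a \<Rightarrow>\<^sub>L 'a"
  assumes sk: "\<mu> \<in> skew_maps" and uni: "\<And>y. tr (\<mu> y) = 0"
    and kill: "tr (\<lambda>y. \<mu> x (\<mu> x y)) = 0"
  shows "tr (\<lambda>z. koszul \<mu> z (koszul \<mu> x x) - koszul \<mu> x (koszul \<mu> z x) - koszul \<mu> (\<mu> z x) x)
    = ric_form \<mu> x"
proof -
  \<comment> \<open>\<alpha> is the matrix of minus the bracket with \<open>x\<close>, while
    \<gamma> collects the components of brackets along \<open>x\<close> and is skew in its two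
    indices.\<close>
  define \<alpha> where "\<alpha> e w = \<mu> e x \<bullet> w" for e w
  define \<gamma> where "\<gamma> e w = \<mu> w e \<bullet> x" for e w
  let ?S = "\<lambda>f :: 'a \<Rightarrow> 'a \<Rightarrow> real. \<Sum>e\<in>Basis. \<Sum>w\<in>Basis. f e w"
  have g: "\<gamma> w e = - \<gamma> e w" for e w
    using skew_mapsD[OF sk, of e w] by (simp add: \<gamma>_def)
  \<comment> \<open>Since \<open>koszul \<mu> x\<close> is skew, it can be moved to the other
    factor. The two factors are then half of \<open>A + \<alpha> e w\<close> and half of
    \<open>A - \<alpha> e w\<close> with \<open>A = \<alpha> w e + \<gamma> e w\<close>, and their
    product is a difference of squares.\<close>
  have 1: "- (koszul \<mu> x (koszul \<mu> e x) \<bullet> e)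
      = (\<Sum>w\<in>Basis. ((\<alpha> w e + \<gamma> e w)\<^sup>2 - (\<alpha> e w)\<^sup>2) / 4)" for e
  proof -
    have "- (koszul \<mu> x (koszul \<mu> e x) \<bullet> e) = koszul \<mu> e x \<bullet> koszul \<mu> x e"
      using koszul_skew[OF sk, of x "koszul \<mu> e x" e] by (simp add: inner_commute)
    also have "\<dots> = (\<Sum>w\<in>Basis. (koszul \<mu> e x \<bullet> w) * (koszul \<mu> x e \<bullet> w))"
      by (rule euclidean_inner)
    also have "\<dots> = (\<Sum>w\<in>Basis. ((\<alpha> w e + \<gamma> e w)\<^sup>2 - (\<alpha> e w)\<^sup>2) / 4)"
    proof (intro sum.cong refl)
      fix w
      have "koszul \<mu> e x \<bullet> w = (\<alpha> e w + \<alpha> w e + \<gamma> e w) / 2"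
        using skew_mapsD[OF sk, of x w] by (simp add: koszul_inner \<alpha>_def \<gamma>_def)
      note p = this
      have q: "koszul \<mu> x e \<bullet> w = (- \<alpha> e w + \<alpha> w e + \<gamma> e w) / 2"
        using skew_mapsD[OF sk, of x e] skew_mapsD[OF sk, of e w]
        by (simp add: koszul_inner \<alpha>_def \<gamma>_def)
      show "(koszul \<mu> e x \<bullet> w) * (koszul \<mu> x e \<bullet> w)
          = ((\<alpha> w e + \<gamma> e w)\<^sup>2 - (\<alpha> e w)\<^sup>2) / 4"
        unfolding p q by (simp add: power2_eq_square field_simps)
    qed
    finally show ?thesis .
  qed
  have 2: "koszul \<mu> (\<mu> e x) x \<bullet> e
      = \<mu> x (\<mu> x e) \<bullet> e / 2 + (\<Sum>w\<in>Basis. (\<alpha> e w)\<^sup>2 / 2 - \<alpha> e w * \<gamma> e w / 2)" for e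
  proof -
    let ?u = "\<mu> e x"
    have "koszul \<mu> ?u x \<bullet> e = (\<mu> ?u x \<bullet> e - \<mu> x e \<bullet> ?u + \<mu> e ?u \<bullet> x) / 2"
      by (rule koszul_inner)
    moreover have "\<mu> ?u x = \<mu> x (\<mu> x e)"
      using skew_mapsD[OF sk, of ?u x] skew_mapsD[OF sk, of e x] by (simp add: blinfun.minus_right)
    moreover have "\<mu> x e \<bullet> ?u = - (\<Sum>w\<in>Basis. (\<alpha> e w)\<^sup>2)"
      using skew_mapsD[OF sk, of x e] euclidean_inner[of ?u ?u]
      by (simp add: \<alpha>_def power2_eq_square)
    moreover have "\<mu> e ?u \<bullet> x = - (\<Sum>w\<in>Basis. \<alpha> e w * \<gamma> e w)"
    proof -
      have "\<mu> e ?u = \<mu> e (\<Sum>w\<in>Basis. (?u \<bullet> w) *\<^sub>R w)" by (simp add: euclidean_representation)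
      then have "\<mu> e ?u \<bullet> x = (\<Sum>w\<in>Basis. \<alpha> e w * (\<mu> e w \<bullet> x))"
        by (simp add: blinfun.sum_right blinfun.scaleR_right inner_sum_left \<alpha>_def)
      moreover have "\<mu> e w \<bullet> x = - \<gamma> e w" for w
        using skew_mapsD[OF sk, of e w] by (simp add: \<gamma>_def)
      ultimately show ?thesis by (simp add: sum_negf)
    qed
    ultimately show ?thesis
      by (simp add: sum_subtractf sum_divide_distrib[symmetric])
  qed
  have "tr (\<lambda>z. koszul \<mu> z (koszul \<mu> x x) - koszul \<mu> x (koszul \<mu> z x) - koszul \<mu> (\<mu> z x) x)
    = tr (\<lambda>z. koszul \<mu> z (koszul \<mu> x x))
      + (\<Sum>e\<in>Basis. - (koszul \<mu> x (koszul \<mu> e x) \<bullet> e)) - (\<Sum>e\<in>Basis. koszul \<mu> (\<mu> e x) x \<bullet> e)"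
    by (simp add: tr_diff) (simp add: tr_def sum_negf)
  also have "tr (\<lambda>z. koszul \<mu> z (koszul \<mu> x x)) = 0"
    by (rule tr_koszul_left[OF sk uni])
  also have "(\<Sum>e\<in>Basis. koszul \<mu> (\<mu> e x) x \<bullet> e)
      = tr (\<lambda>y. \<mu> x (\<mu> x y)) / 2 + ?S (\<lambda>e w. (\<alpha> e w)\<^sup>2 / 2 - \<alpha> e w * \<gamma> e w / 2)"
    unfolding 2 by (simp add: sum.distrib tr_def sum_divide_distrib)
  also have "(\<Sum>e\<in>Basis. - (koszul \<mu> x (koszul \<mu> e x) \<bullet> e))
      = (?S (\<lambda>e w. (\<alpha> w e)\<^sup>2) + 2 * ?S (\<lambda>e w. \<alpha> w e * \<gamma> e w) + ?S (\<lambda>e w. (\<gamma> e w)\<^sup>2)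
         - ?S (\<lambda>e w. (\<alpha> e w)\<^sup>2)) / 4"
    unfolding 1
    by (simp add: power2_sum sum.distrib sum_subtractf sum_divide_distrib[symmetric]
        sum_distrib_left mult.assoc add_divide_distrib diff_divide_distrib)
  also have "?S (\<lambda>e w. (\<alpha> w e)\<^sup>2) = ?S (\<lambda>e w. (\<alpha> e w)\<^sup>2)"
    by (rule sum.swap)
  \<comment> \<open>Exchanging the indices and using that \<gamma> is skew brings this sum to the
    form of the mixed term in \<open>2\<close>, so that the two cancel.\<close>
  also have "?S (\<lambda>e w. \<alpha> w e * \<gamma> e w) = - ?S (\<lambda>e w. \<alpha> e w * \<gamma> e w)"
  proof -
    have "?S (\<lambda>e w. \<alpha> w e * \<gamma> e w) = ?S (\<lambda>e w. \<alpha> e w * \<gamma> w e)" by (rule sum.swap)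
    also have "\<dots> = ?S (\<lambda>e w. - (\<alpha> e w * \<gamma> e w))"
    proof (intro sum.cong refl)
      show "\<alpha> e w * \<gamma> w e = - (\<alpha> e w * \<gamma> e w)" for e w using g[of w e] by simp
    qed
    finally show ?thesis by (simp only: sum_negf)
  qed
  finally have "tr (\<lambda>z. koszul \<mu> z (koszul \<mu> x x) - koszul \<mu> x (koszul \<mu> z x) - koszul \<mu> (\<mu> z x) x)
      = ?S (\<lambda>e w. (\<gamma> e w)\<^sup>2) / 4 - ?S (\<lambda>e w. (\<alpha> e w)\<^sup>2) / 2"
    using kill by (simp add: sum_subtractf sum_divide_distrib[symmetric] field_simps)
  also have "?S (\<lambda>e w. (\<gamma> e w)\<^sup>2) = (\<Sum>i\<in>Basis. \<Sum>j\<in>Basis. (\<mu> i j \<bullet> x)\<^sup>2)"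
    unfolding \<gamma>_def by (rule sum.swap)
  also have "?S (\<lambda>e w. (\<alpha> e w)\<^sup>2) = (\<Sum>i\<in>Basis. \<mu> x i \<bullet> \<mu> x i)"
  proof (intro sum.cong refl)
    fix e
    show "(\<Sum>w\<in>Basis. (\<alpha> e w)\<^sup>2) = \<mu> x e \<bullet> \<mu> x e"
      using skew_mapsD[OF sk, of x e] euclidean_inner[of "\<mu> e x" "\<mu> e x"]
      by (simp add: \<alpha>_def power2_eq_square)
  qed
  finally show ?thesis by (simp add: ric_form_def)
qed

section \<open>The moment map as a multiple of the Ricci form\<close>

lemma skew_inner_eq: "skew_inner \<mu> \<mu> = (\<Sum>i\<in>Basis. \<Sum>j\<in>Basis. (norm (\<mu> i j))\<^sup>2) / 2"
  unfolding skew_inner_def power2_norm_eq_inner by (simp only: euclidean_inner[symmetric])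

lemma skew_inner_pos:
  assumes "\<mu> \<noteq> 0"
  shows "0 < skew_inner \<mu> \<mu>"
proof (rule ccontr)
  assume "\<not> ?thesis"
  moreover have "0 \<le> skew_inner \<mu> \<mu>"
    unfolding skew_inner_eq by (intro divide_nonneg_nonneg sum_nonneg) auto
  ultimately have "(\<Sum>i\<in>Basis. \<Sum>j\<in>Basis. (norm (\<mu> i j))\<^sup>2) = 0"
    unfolding skew_inner_eq by linarith
  then have "\<forall>i\<in>Basis. \<forall>j\<in>Basis. \<mu> i j = 0"
    by (simp add: sum_nonneg_eq_0_iff sum_nonneg)
  then have "\<mu> = 0"
    by (intro blinfun_euclidean_eqI) simp
  then show False using assms by simp
qed

text \<open>The moment map is tested on the rank one symmetric operator \<open>E\<close> sending
  \<open>y\<close> to \<open>(x \<bullet> y) *\<^sub>R x\<close>. Pairing with it evaluates a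
  quadratic form at \<open>x\<close>, and the derivative of the action along it gives twice the
  Ricci form.\<close>

lemma moment_inner:
  fixes \<mu> :: "'a::euclidean_space \<Rightarrow>\<^sub>L 'a \<Rightarrow>\<^sub>L 'a"
  assumes sk: "\<mu> \<in> skew_maps"
  shows "moment \<mu> x \<bullet> x = 2 * ric_form \<mu> x / skew_inner \<mu> \<mu>"
proof -
  define E :: "'a \<Rightarrow>\<^sub>L 'a" where "E = blinfun_scaleR_left x o\<^sub>L blinfun_inner_left x"
  have E: "E y = (x \<bullet> y) *\<^sub>R x" for y by (simp add: E_def inner_commute)
  have m: "is_moment \<mu> (moment \<mu>)"
    unfolding moment_def by (rule theI'[OF moment_ex1])
  have "E \<in> sym_ops" by (simp add: sym_ops_def E inner_commute)
  with m have "gl_inner (moment \<mu>) E = skew_inner (gl_act E \<mu>) \<mu> / skew_inner \<mu> \<mu>"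
    by (simp add: is_moment_def)
  moreover have "gl_inner (moment \<mu>) E = moment \<mu> x \<bullet> x"
  proof -
    have "moment \<mu> x = moment \<mu> (\<Sum>j\<in>Basis. (x \<bullet> j) *\<^sub>R j)" by (simp add: euclidean_representation)
    then have "moment \<mu> x \<bullet> x = (\<Sum>j\<in>Basis. (x \<bullet> j) * (moment \<mu> j \<bullet> x))"
      by (simp add: blinfun.sum_right blinfun.scaleR_right inner_sum_left)
    then show ?thesis by (simp add: gl_inner_Basis E)
  qed
  moreover have "skew_inner (gl_act E \<mu>) \<mu> = 2 * ric_form \<mu> x"
  proof -
    have "(\<Sum>k\<in>Basis. (gl_act E \<mu> i j \<bullet> k) * (\<mu> i j \<bullet> k))
        = (\<mu> i j \<bullet> x)\<^sup>2 - (x \<bullet> i) * (\<mu> x j \<bullet> \<mu> i j) - (x \<bullet> j) * (\<mu> i x \<bullet> \<mu> i j)" for i j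
      by (subst euclidean_inner[symmetric]) (simp add: gl_act_apply E blinfun.bilinear_simps inner_diff_right
          power2_eq_square inner_commute)
    then have "skew_inner (gl_act E \<mu>) \<mu> = ((\<Sum>i\<in>Basis. \<Sum>j\<in>Basis. (\<mu> i j \<bullet> x)\<^sup>2)
        - (\<Sum>i\<in>Basis. \<Sum>j\<in>Basis. (x \<bullet> i) * (\<mu> x j \<bullet> \<mu> i j))
        - (\<Sum>i\<in>Basis. \<Sum>j\<in>Basis. (x \<bullet> j) * (\<mu> i x \<bullet> \<mu> i j))) / 2"
      by (simp add: skew_inner_def sum_subtractf)
    also have "(\<Sum>i\<in>Basis. \<Sum>j\<in>Basis. (x \<bullet> i) * (\<mu> x j \<bullet> \<mu> i j)) = (\<Sum>j\<in>Basis. \<mu> x j \<bullet> \<mu> x j)"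
    proof (subst sum.swap, intro sum.cong refl)
      fix j
      have "\<mu> x j = \<mu> (\<Sum>i\<in>Basis. (x \<bullet> i) *\<^sub>R i) j" by (simp add: euclidean_representation)
      then have "\<mu> x j \<bullet> v = (\<Sum>i\<in>Basis. (x \<bullet> i) * (v \<bullet> \<mu> i j))" for v
        by (simp add: blinfun.sum_right blinfun.sum_left blinfun.bilinear_simps inner_sum_left inner_sum_right inner_commute)
      then show "(\<Sum>i\<in>Basis. (x \<bullet> i) * (\<mu> x j \<bullet> \<mu> i j)) = \<mu> x j \<bullet> \<mu> x j" by simp
    qed
    also have "(\<Sum>i\<in>Basis. \<Sum>j\<in>Basis. (x \<bullet> j) * (\<mu> i x \<bullet> \<mu> i j)) = (\<Sum>i\<in>Basis. \<mu> x i \<bullet> \<mu> x i)"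
    proof (intro sum.cong refl)
      fix i
      have "\<mu> i x = \<mu> i (\<Sum>j\<in>Basis. (x \<bullet> j) *\<^sub>R j)" by (simp add: euclidean_representation)
      then have "\<mu> i x \<bullet> v = (\<Sum>j\<in>Basis. (x \<bullet> j) * (v \<bullet> \<mu> i j))" for v
        by (simp add: blinfun.sum_right blinfun.bilinear_simps inner_sum_left inner_sum_right inner_commute)
      then show "(\<Sum>j\<in>Basis. (x \<bullet> j) * (\<mu> i x \<bullet> \<mu> i j)) = \<mu> x i \<bullet> \<mu> x i"
        using skew_mapsD[OF sk, of x i] by simp
    qed
    finally show ?thesis by (simp add: ric_form_def)
  qed
  ultimately show ?thesis by simp
qed

subsection \<open>Ricci curvature of a semidirect sum\<close>

lemma levi_civita_eqI:
  assumes "inner_product_form ip" "bilinear br" "\<And>x y. br x y = - br y x" "is_levi_civita br ip N"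
  shows "levi_civita br ip = N"
  unfolding levi_civita_def by (intro the1_equality levi_civita_ex1 assms)

text \<open>\<open>T\<close> is an isometry that intertwines the two brackets, so it pulls the
  connection \<open>N\<close> back to the Levi-Civita connection of \<open>ip\<close>, and the trace
  is invariant under conjugation. Ricci forms can thus be computed with an explicit connection for
  the standard inner product.\<close>

lemma ricci_transport:
  fixes T :: "'b::euclidean_space \<Rightarrow> 'c::euclidean_space"
  assumes T: "linear T" and S: "linear S" and TS: "\<And>x. T (S x) = x" and ST: "\<And>x. S (T x) = x"
    and bil: "bilinear br'" and sk: "\<And>x y. br' x y = - br' y x"
    and br: "\<And>x y. br x y = S (br' (T x) (T y))" and ip: "\<And>x y. ip x y = T x \<bullet> T y"
    and N: "is_levi_civita br' (\<bullet>) N"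
  shows "ricci br ip x y = tr (\<lambda>z. N z (N (T x) (T y)) - N (T x) (N z (T y)) - N (br' z (T x)) (T y))"
proof -
  have pull: "bilinear (\<lambda>x y. S (F (T x) (T y)))" if "bilinear F" for F
    using that T S by (simp add: bilinear_def linear_iff)
  have Nb: "bilinear N" and Nt: "\<And>x y. N x y - N y x = br' x y"
    and Nm: "\<And>x y z. N x y \<bullet> z + y \<bullet> N x z = 0"
    using N by (auto simp: is_levi_civita_def)
  have "bilinear ip"
    using T by (auto simp: bilinear_def linear_iff ip inner_add)
  moreover have "0 < ip x x" if "x \<noteq> 0" for x
    using ST[of x] that linear_0[OF S] by (auto simp: ip)
  ultimately have 1: "inner_product_form ip"
    by (simp add: inner_product_form_def ip inner_commute)
  have brf: "br = (\<lambda>x y. S (br' (T x) (T y)))" by (intro ext br)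
  have 2: "br x y = - br y x" for x y
    unfolding br by (subst sk) (rule linear_neg[OF S])
  have "levi_civita br ip = (\<lambda>x y. S (N (T x) (T y)))"
  proof (rule levi_civita_eqI[OF 1 _ 2])
    show "bilinear br" unfolding brf by (rule pull[OF bil])
    show "is_levi_civita br ip (\<lambda>x y. S (N (T x) (T y)))"
      unfolding is_levi_civita_def
      by (intro conjI allI pull[OF Nb]) (simp_all add: linear_diff[OF S, symmetric] Nt br ip TS Nm)
  qed
  then have "ricci br ip x y
      = tr (\<lambda>z. S (N (T z) (N (T x) (T y)) - N (T x) (N (T z) (T y)) - N (br' (T z) (T x)) (T y)))"
    by (simp add: ricci_def curvature_def TS br linear_diff[OF S])
  also have "\<dots> = tr (\<lambda>z. N z (N (T x) (T y)) - N (T x) (N z (T y)) - N (br' z (T x)) (T y))"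
  proof (rule tr_conjugate[OF T S _ TS])
    show "linear (\<lambda>z. N z (N (T x) (T y)) - N (T x) (N z (T y)) - N (br' z (T x)) (T y))"
      using Nb bil by (auto simp: bilinear_def linear_iff algebra_simps)
  qed
  finally show ?thesis .
qed

text \<open>For symmetric \<open>E\<close> and a unit normal \<open>f\<close> this is the
  Levi-Civita connection: \<open>f\<close> differentiates every left-invariant field to zero, the
  derivative of \<open>f\<close> along \<open>x\<close> is \<open>- E x\<close>, and
  \<open>E\<close> is the second fundamental form of the ideal.\<close>

definition semidirect_connection ::
    "('a::euclidean_space \<Rightarrow>\<^sub>L 'a \<Rightarrow>\<^sub>L 'a) \<Rightarrow> ('a \<Rightarrow>\<^sub>L 'a) \<Rightarrow> real \<times> 'a \<Rightarrow> real \<times> 'a \<Rightarrow> real \<times> 'a" where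
  "semidirect_connection \<mu> E p q =
     (E (snd p) \<bullet> snd q, koszul \<mu> (snd p) (snd q) - fst q *\<^sub>R E (snd p))"

lemma bilinear_semidirect: "bilinear (semidirect \<mu> E)"
  by (auto simp: bilinear_def linear_iff semidirect_def blinfun.bilinear_simps algebra_simps)

lemma semidirect_skew: "\<mu> \<in> skew_maps \<Longrightarrow> semidirect \<mu> E p q = - semidirect \<mu> E q p"
  using skew_mapsD[of \<mu> "snd p" "snd q"] by (simp add: semidirect_def)

lemma is_levi_civita_semidirect:
  assumes sk: "\<mu> \<in> skew_maps" and E: "E \<in> sym_ops"
  shows "is_levi_civita (semidirect \<mu> E) (\<bullet>) (semidirect_connection \<mu> E)"
proof -
  have sE: "E x \<bullet> y = E y \<bullet> x" for x y
    using E by (metis (mono_tags, lifting) inner_commute mem_Collect_eq sym_ops_def)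
  have "bilinear (semidirect_connection \<mu> E)"
    using bilinear_koszul[of \<mu>]
    by (auto simp: bilinear_def linear_iff semidirect_connection_def blinfun.bilinear_simps algebra_simps inner_add)
  moreover have "semidirect_connection \<mu> E p q - semidirect_connection \<mu> E q p = semidirect \<mu> E p q" for p q
    using koszul_torsion[OF sk, of "snd p" "snd q"] sE[of "snd p" "snd q"]
    by (simp add: semidirect_connection_def semidirect_def algebra_simps)
  moreover have "semidirect_connection \<mu> E p q \<bullet> r + q \<bullet> semidirect_connection \<mu> E p r = 0" for p q r
    using koszul_skew[OF sk, of "snd p" "snd q" "snd r"]
    by (simp add: semidirect_connection_def inner_prod_def inner_diff inner_commute algebra_simps)
  ultimately show ?thesis by (simp add: is_levi_civita_def)
qed

text \<open>The trace is split into the \<open>f\<close> direction and the ideal. The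
  \<open>f\<close> direction gives \<open>- (E x \<bullet> E x)\<close>, which cancels against
  \<open>t4\<close>; the terms linear in \<open>a\<close> have trace zero, and the rest is the Ricci
  form of \<mu> corrected by \<open>tr E\<close> and by the trace of the square of
  \<open>E\<close>.\<close>

lemma tr_semidirect_curvature:
  fixes \<mu> :: "'a::euclidean_space \<Rightarrow>\<^sub>L 'a \<Rightarrow>\<^sub>L 'a"
  assumes sk: "\<mu> \<in> skew_maps" and E: "E \<in> sym_ops" and uni: "\<And>y. tr (\<mu> y) = 0"
    and kill: "\<And>x. tr (\<lambda>y. \<mu> x (\<mu> x y)) = 0" and Ead: "\<And>x. tr (\<lambda>y. E (\<mu> x y)) = 0"
  defines "N \<equiv> semidirect_connection \<mu> E"
  shows "tr (\<lambda>z. N z (N (a, x) (a, x)) - N (a, x) (N z (a, x)) - N (semidirect \<mu> E z (a, x)) (a, x))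
    = ric_form \<mu> x - tr E * (E x \<bullet> x) - a\<^sup>2 * tr (\<lambda>y. E (E y))"
proof -
  let ?K = "koszul \<mu>"
  note K = bilinear_ladd[OF bilinear_koszul] bilinear_radd[OF bilinear_koszul]
    bilinear_lsub[OF bilinear_koszul] bilinear_rsub[OF bilinear_koszul]
    bilinear_lmul[OF bilinear_koszul] bilinear_rmul[OF bilinear_koszul]
    bilinear_lneg[OF bilinear_koszul] bilinear_rneg[OF bilinear_koszul]
    bilinear_lzero[OF bilinear_koszul] bilinear_rzero[OF bilinear_koszul]
  have sE: "E x \<bullet> y = E y \<bullet> x" for x y
    using E by (metis (mono_tags, lifting) inner_commute mem_Collect_eq sym_ops_def)
  have Ead': "tr (\<lambda>e. \<mu> y (E e)) = 0" for y
    using tr_comp_commute[OF linear_blinfun_apply linear_blinfun_apply, of "\<mu> y" E] Ead by simp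
  have Ead'': "tr (\<lambda>e. E (\<mu> e y)) = 0" for y
  proof -
    have "E (\<mu> e y) = (-1) *\<^sub>R E (\<mu> y e)" for e
      using skew_mapsD[OF sk, of e y] by (simp add: blinfun.minus_right)
    then show ?thesis by (simp only: tr_cmul Ead)
  qed
  have t1: "tr (\<lambda>e. ?K e y) = 0" for y by (rule tr_koszul_left[OF sk uni])
  \<comment> \<open>The trace of a skew operator times a symmetric one equals its own
    negative.\<close>
  have t2: "tr (\<lambda>e. ?K x (E e)) = 0"
  proof -
    have "linear (?K x)" using bilinear_koszul by (auto simp: bilinear_def)
    then have "tr (\<lambda>e. ?K x (E e)) = tr (\<lambda>e. E (?K x e))"
      by (rule tr_comp_commute) (rule linear_blinfun_apply)
    also have "\<dots> = (\<Sum>e\<in>Basis. - (?K x (E e) \<bullet> e))"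
      unfolding tr_def
    proof (intro sum.cong refl)
      fix e show "E (?K x e) \<bullet> e = - (?K x (E e) \<bullet> e)"
        using koszul_skew[OF sk, of x e "E e"] sE[of "?K x e" e] by (simp add: inner_commute)
    qed
    also have "\<dots> = - tr (\<lambda>e. ?K x (E e))" by (simp add: tr_def sum_negf)
    finally show ?thesis by simp
  qed
  \<comment> \<open>The Koszul formula splits this into two traces of products of \<open>E\<close>
    with the bracket by \<open>x\<close>, and a contraction of the skew \<mu> with the symmetric
    \<open>E\<close>.\<close>
  have t3: "tr (\<lambda>e. ?K (E e) x) = 0"
  proof -
    have "?K (E e) x \<bullet> e = - (\<mu> x (E e) \<bullet> e) / 2 - E (\<mu> x e) \<bullet> e / 2 + (\<mu> e (E e) \<bullet> x) / 2" for e
      using skew_mapsD[OF sk, of "E e" x] sE[of "\<mu> x e" e]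
      unfolding koszul_inner by (simp add: inner_commute field_simps)
    then have "tr (\<lambda>e. ?K (E e) x)
        = - tr (\<lambda>e. \<mu> x (E e)) / 2 - tr (\<lambda>e. E (\<mu> x e)) / 2 + ((\<Sum>e\<in>Basis. \<mu> e (E e)) \<bullet> x) / 2"
      by (simp add: tr_def sum.distrib sum_subtractf sum_negf sum_divide_distrib inner_sum_left)
    then show ?thesis using Ead[of x] Ead'[of x] by (simp add: sum_skew_sym_eq_0[OF sk E])
  qed
  have t4: "tr (\<lambda>e. (E e \<bullet> x) *\<^sub>R E x) = E x \<bullet> E x"
    using euclidean_inner[of "E x" "E x"] by (simp add: tr_def sE[of _ x])
  have "tr (\<lambda>z. N z (N (a, x) (a, x)) - N (a, x) (N z (a, x)) - N (semidirect \<mu> E z (a, x)) (a, x))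
      = - (E x \<bullet> E x) + tr (\<lambda>e. (?K e (?K x x) - ?K x (?K e x) - ?K (\<mu> e x) x)
          - a *\<^sub>R ?K e (E x) - (E x \<bullet> x) *\<^sub>R E e + a *\<^sub>R ?K x (E e) + (E e \<bullet> x) *\<^sub>R E x
          + a *\<^sub>R ?K (E e) x - a\<^sup>2 *\<^sub>R E (E e) + a *\<^sub>R E (\<mu> e x))"
    unfolding tr_prod_real
    by (simp add: N_def semidirect_connection_def semidirect_def K blinfun.bilinear_simps sE[of "E x" x]
        algebra_simps power2_eq_square)
  also have "\<dots> = ric_form \<mu> x - tr E * (E x \<bullet> x) - a\<^sup>2 * tr (\<lambda>y. E (E y))"
    using tr_koszul_curvature[OF sk uni kill, of x]
    unfolding tr_add tr_diff tr_cmul t1 t2 t3 t4 Ead'' by (simp add: mult.commute)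
  finally show ?thesis .
qed

subsection \<open>Square roots in the centralizer\<close>

lemma GL_I:
  fixes g :: "'a::euclidean_space \<Rightarrow>\<^sub>L 'a"
  assumes "\<And>x. g x = 0 \<Longrightarrow> x = 0"
  shows "g \<in> GL"
proof -
  have "inj (blinfun_apply g)"
    by (simp add: linear_injective_0[OF linear_blinfun_apply] assms)
  then show ?thesis
    using linear_injective_imp_surjective[OF linear_blinfun_apply _ refl] by (auto simp: GL_def bij_def)
qed

lemma id_minus_small_in_GL:
  fixes Y :: "'a::euclidean_space \<Rightarrow>\<^sub>L 'a"
  assumes "norm Y < 1" "k \<noteq> 0"
  shows "k *\<^sub>R (id_blinfun - Y) \<in> GL"
proof (rule GL_I)
  fix x assume "(k *\<^sub>R (id_blinfun - Y)) x = 0"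
  then have "x = Y x" using assms(2) by (simp add: blinfun.bilinear_simps)
  then have "norm x \<le> norm Y * norm x" by (metis norm_blinfun)
  then have "(1 - norm Y) * norm x \<le> 0" by (simp add: algebra_simps)
  then show "x = 0" using assms(1) by (simp add: mult_le_0_iff)
qed

text \<open>The constant is the minimum of the quadratic form on the compact unit sphere.\<close>

lemma pos_ops_coercive:
  fixes P :: "'a::euclidean_space \<Rightarrow>\<^sub>L 'a"
  assumes "P \<in> pos_ops"
  obtains m where "0 < m" "\<And>x. m * (norm x)\<^sup>2 \<le> P x \<bullet> x"
proof -
  have "sphere (0::'a) 1 \<noteq> {}" by (auto simp: sphere_eq_empty)
  moreover have "continuous_on (sphere 0 1) (\<lambda>x. P x \<bullet> x)" by (intro continuous_intros)
  ultimately obtain u where "u \<in> sphere 0 1" and min': "\<forall>x\<in>sphere 0 1. P u \<bullet> u \<le> P x \<bullet> x"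
    using continuous_attains_inf[OF compact_sphere] by blast
  then have u: "norm u = 1" by simp
  have min: "P u \<bullet> u \<le> P x \<bullet> x" if "norm x = 1" for x
    by (rule bspec[OF min']) (simp add: that)
  show thesis
  proof
    have "u \<noteq> 0" using u by auto
    then show "0 < P u \<bullet> u" using assms by (simp add: pos_ops_def)
    fix x
    show "P u \<bullet> u * (norm x)\<^sup>2 \<le> P x \<bullet> x"
    proof (cases "x = 0")
      case False
      have "P u \<bullet> u \<le> P (x /\<^sub>R norm x) \<bullet> (x /\<^sub>R norm x)"
        by (rule min) (use False in simp)
      also have "\<dots> = P x \<bullet> x / (norm x)\<^sup>2"
        by (simp add: blinfun.scaleR_right power2_eq_square divide_inverse)
      finally show ?thesis using False by (simp add: pos_le_divide_eq)
    qed simp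
  qed
qed

text \<open>
  For small \<open>s > 0\<close> the operator \<open>A = 1 - s P\<close> is a contraction, and \<open>1 - Y\<close> is a square root of
  \<open>s P\<close> when \<open>Y\<close> is the fixed point of \<open>Y \<mapsto> (A + Y\<^sup>2) / 2\<close> in the symmetric operators
  commuting with \<open>D\<close>.  The segment from \<open>1\<close> to \<open>1 - Y\<close> keeps the root in the identity component.
\<close>

lemma pos_op_as_square:
  fixes P :: "'a::euclidean_space \<Rightarrow>\<^sub>L 'a"
  assumes P: "P \<in> pos_ops" and PD: "P o\<^sub>L D = D o\<^sub>L P"
  shows "\<exists>g\<in>centralizer_comp D. \<forall>x y. g x \<bullet> g y = P x \<bullet> y"
proof -
  obtain m where m: "0 < m" and mP: "\<And>x. m * (norm x)\<^sup>2 \<le> P x \<bullet> x"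
    using pos_ops_coercive[OF P] by blast
  define L where "L = norm P"
  have mL: "m \<le> L"
  proof -
    obtain u :: 'a where "u \<in> Basis" using nonempty_Basis by blast
    then have u: "norm u = 1" by simp
    have "m \<le> P u \<bullet> u" using mP[of u] u by simp
    also have "\<dots> \<le> norm (P u) * norm u" by (rule norm_cauchy_schwarz)
    also have "\<dots> \<le> L" using norm_blinfun[of P u] u by (simp add: L_def)
    finally show ?thesis .
  qed
  with m have L: "0 < L" by simp
  \<comment> \<open>This value minimizes the bound
    \<open>1 - 2 * s * m + s\<^sup>2 * L\<^sup>2\<close> for the squared norm of \<open>A\<close>.
    The minimum is \<open>q\<^sup>2\<close>, and \<open>0 < m\<close> with \<open>m \<le> L\<close>
    puts \<open>q\<close> in the interval from 0 to 1, with 1 excluded.\<close>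
  define s where "s = m / L\<^sup>2"
  have s: "0 < s" using m L by (simp add: s_def)
  define q where "q = sqrt (1 - (m / L)\<^sup>2)"
  have "(m / L)\<^sup>2 \<le> 1" using m mL L by (simp add: power_le_one_iff)
  moreover have "0 < (m / L)\<^sup>2" using m L by simp
  ultimately have q: "0 \<le> q" "q < 1" and q2: "q\<^sup>2 = 1 - (m / L)\<^sup>2"
    by (auto simp: q_def)
  define A where "A = id_blinfun - s *\<^sub>R P"
  have symP: "P x \<bullet> y = x \<bullet> P y" for x y using P by (auto simp: pos_ops_def sym_ops_def)
  have A_norm: "norm A \<le> q"
  proof (rule norm_blinfun_bound[OF q(1)])
    fix x
    have "(norm (A x))\<^sup>2 = (norm x)\<^sup>2 - 2 * s * (P x \<bullet> x) + s\<^sup>2 * (norm (P x))\<^sup>2"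
      unfolding power2_norm_eq_inner
      by (simp add: A_def blinfun.bilinear_simps inner_diff inner_commute power2_eq_square algebra_simps)
    also have "\<dots> \<le> (norm x)\<^sup>2 - 2 * s * (m * (norm x)\<^sup>2) + s\<^sup>2 * (L * norm x)\<^sup>2"
      using mP[of x] s norm_blinfun[of P x]
      by (intro add_mono diff_mono mult_left_mono power_mono) (auto simp: L_def)
    also have "\<dots> = (q * norm x)\<^sup>2"
      unfolding power_mult_distrib[of q] q2 using L
      by (simp add: s_def field_simps power2_eq_square)
    finally show "norm (A x) \<le> q * norm x"
      by (rule power2_le_imp_le) (use q in simp)
  qed
  \<comment> \<open>The radius \<open>q\<close> is preserved because \<open>F Y\<close> averages
    \<open>A\<close> and the square of \<open>Y\<close>, both of norm at most \<open>q\<close>.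
    Symmetry and commutation with \<open>D\<close> are closed conditions, so the fixed point
    inherits them.\<close>
  define X where "X = {Y :: 'a \<Rightarrow>\<^sub>L 'a. norm Y \<le> q \<and>
    (\<forall>x y. blinfun_apply Y x \<bullet> y = x \<bullet> blinfun_apply Y y) \<and> Y o\<^sub>L D = D o\<^sub>L Y}"
  define F :: "('a \<Rightarrow>\<^sub>L 'a) \<Rightarrow> 'a \<Rightarrow>\<^sub>L 'a" where "F Y = (1/2) *\<^sub>R (A + (Y o\<^sub>L Y))" for Y
  have "closed X"
    unfolding X_def
    by (intro closed_Collect_conj closed_Collect_all closed_Collect_eq closed_Collect_le continuous_intros)
  then have "complete X" by (simp add: complete_eq_closed)
  moreover have "X \<noteq> {}"
    using q by (auto simp: X_def blinfun.bilinear_simps intro!: exI[of _ 0] blinfun_eqI)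
  moreover have "F ` X \<subseteq> X"
  proof (rule image_subsetI)
    fix Y assume Y: "Y \<in> X"
    then have nY: "norm Y \<le> q" and sY: "\<And>x y. Y x \<bullet> y = x \<bullet> Y y" and YD: "Y o\<^sub>L D = D o\<^sub>L Y"
      unfolding X_def by blast+
    have cY: "Y (D x) = D (Y x)" for x using YD by (metis blinfun_apply_blinfun_compose)
    have "norm (Y o\<^sub>L Y) \<le> q * 1"
      using norm_blinfun_compose[of Y Y] mult_mono[OF nY, of "norm Y" 1] nY q by auto
    then have "norm (F Y) \<le> q"
      using norm_triangle_ineq[of A "Y o\<^sub>L Y"] A_norm by (simp add: F_def)
    moreover have "F Y x \<bullet> y = x \<bullet> F Y y" for x y
      by (simp add: F_def A_def blinfun.bilinear_simps inner_add inner_diff sY symP)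
    moreover have "F Y o\<^sub>L D = D o\<^sub>L F Y"
    proof (rule blinfun_eqI)
      fix x
      have "P (D x) = D (P x)" using PD by (metis blinfun_apply_blinfun_compose)
      then show "(F Y o\<^sub>L D) x = (D o\<^sub>L F Y) x"
        by (simp add: F_def A_def blinfun.bilinear_simps cY)
    qed
    ultimately show "F Y \<in> X" by (simp add: X_def)
  qed
  moreover have "dist (F Y) (F Z) \<le> q * dist Y Z" if "Y \<in> X" "Z \<in> X" for Y Z
  proof -
    \<comment> \<open>The operators need not commute, so the difference of squares is written as
      \<open>Y (Y - Z) + (Y - Z) Z\<close>.\<close>
    have "F Y - F Z = (1/2) *\<^sub>R ((Y o\<^sub>L (Y - Z)) + ((Y - Z) o\<^sub>L Z))"
      by (rule blinfun_eqI) (simp add: F_def blinfun.bilinear_simps algebra_simps)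
    moreover have "norm (Y o\<^sub>L (Y - Z)) \<le> q * norm (Y - Z)" "norm ((Y - Z) o\<^sub>L Z) \<le> norm (Y - Z) * q"
      using that q by (auto simp: X_def intro!: order_trans[OF norm_blinfun_compose] mult_mono)
    ultimately show ?thesis
      using norm_triangle_ineq[of "Y o\<^sub>L (Y - Z)" "(Y - Z) o\<^sub>L Z"] by (simp add: dist_norm mult.commute)
  qed
  ultimately obtain Y where Y: "Y \<in> X" and fix_Y: "F Y = Y"
    using Banach_fix[of X q F] q by blast
  from Y have nY: "norm Y \<le> q" and sY: "\<And>x y. Y x \<bullet> y = x \<bullet> Y y" and YD: "Y o\<^sub>L D = D o\<^sub>L Y"
    unfolding X_def by blast+
  have cY: "Y (D x) = D (Y x)" for x using YD by (metis blinfun_apply_blinfun_compose)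
  \<comment> \<open>The fixed point equation, which says that the square of
    \<open>id_blinfun - Y\<close> is \<open>s *\<^sub>R P\<close>.\<close>
  have Y2: "2 *\<^sub>R Y x = x - s *\<^sub>R P x + Y (Y x)" for x
  proof -
    have "2 *\<^sub>R Y x = 2 *\<^sub>R F Y x" by (simp only: fix_Y)
    then show ?thesis by (simp add: F_def A_def blinfun.bilinear_simps)
  qed
  \<comment> \<open>The positive scalar factor runs from 1 to \<open>1 / sqrt s\<close>, so the path
    ends at a square root of \<open>P\<close> itself. It stays invertible because
    \<open>t *\<^sub>R Y\<close> has norm below 1.\<close>
  define \<gamma> where "\<gamma> t = ((1 - t) + t / sqrt s) *\<^sub>R (id_blinfun - t *\<^sub>R Y)" for t :: real
  let ?C = "{g \<in> GL. g o\<^sub>L D = D o\<^sub>L g}"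
  have "\<gamma> t \<in> ?C" if t: "t \<in> {0..1}" for t
  proof -
    have "norm (t *\<^sub>R Y) \<le> 1 * norm Y" unfolding norm_scaleR using t by (intro mult_right_mono) auto
    also have "\<dots> < 1" using nY q by simp
    finally have "norm (t *\<^sub>R Y) < 1" .
    moreover have "0 < (1 - t) + t / sqrt s"
      using t s by (cases "t = 0") (auto intro: add_nonneg_pos)
    ultimately have "\<gamma> t \<in> GL" unfolding \<gamma>_def by (intro id_minus_small_in_GL) auto
    moreover have "\<gamma> t o\<^sub>L D = D o\<^sub>L \<gamma> t"
      by (rule blinfun_eqI) (simp add: \<gamma>_def blinfun.bilinear_simps cY)
    ultimately show ?thesis by simp
  qed
  moreover have "connected (\<gamma> ` {0..1})"
    unfolding \<gamma>_def by (intro connected_continuous_image continuous_intros) (auto simp: s less_imp_neq[symmetric])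
  moreover have "\<gamma> 0 = id_blinfun" by (simp add: \<gamma>_def)
  ultimately have "\<gamma> 1 \<in> centralizer_comp D"
    unfolding centralizer_comp_def connected_component_def mem_Collect_eq
    by (intro exI[of _ "\<gamma> ` {0..1}"]) (auto simp: image_iff intro: bexI[of _ 0] bexI[of _ 1])
  moreover have "\<gamma> 1 x \<bullet> \<gamma> 1 y = P x \<bullet> y" for x y
  proof -
    have "\<gamma> 1 x \<bullet> \<gamma> 1 y = ((x - Y x) \<bullet> (y - Y y)) / s"
      using s by (simp add: \<gamma>_def blinfun.bilinear_simps)
    also have "(x - Y x) \<bullet> (y - Y y) = (x - 2 *\<^sub>R Y x + Y (Y x)) \<bullet> y"
      by (simp add: inner_diff inner_add sY)
    also have "\<dots> = s * (P x \<bullet> y)" unfolding Y2 by (simp add: inner_diff inner_add)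
    finally show ?thesis using s by simp
  qed
  ultimately show ?thesis by blast
qed

subsection \<open>Ricci negative derivations\<close>

lemma GL_inv:
  assumes "g \<in> GL"
  shows "g (inv g x) = x" "inv g (g x) = x" "linear (inv (blinfun_apply g))"
proof -
  show s: "g (inv g x) = x" and i: "inv g (g x) = x" for x
    using assms by (auto simp: GL_def bij_def surj_f_inv_f)
  show "linear (inv (blinfun_apply g))"
    by (rule linearI) (metis s i blinfun.add_right, metis s i blinfun.scaleR_right)
qed

lemma GL_act_skew:
  assumes g: "g \<in> GL" and sk: "\<mu> \<in> skew_maps"
  shows "GL_act g \<mu> \<in> skew_maps"
proof -
  have "g (\<mu> x y) = - g (\<mu> y x)" for x y
    by (subst skew_mapsD[OF sk]) (rule blinfun.minus_right)
  then show ?thesis unfolding skew_maps_def mem_Collect_eq GL_act_apply[OF g] by blast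
qed

lemma centralizer_compD:
  assumes "g \<in> centralizer_comp D"
  shows "g \<in> GL" "g (D x) = D (g x)"
proof -
  have "g \<in> {g \<in> GL. g o\<^sub>L D = D o\<^sub>L g}"
    using assms connected_component_subset unfolding centralizer_comp_def by blast
  then show "g \<in> GL" "g (D x) = D (g x)"
    by (auto dest: arg_cong[where f = "\<lambda>h. blinfun_apply h x"])
qed

text \<open>Bracketing with \<open>y\<close> in the transported bracket is the conjugate by
  \<open>g\<close> of bracketing with \<open>inv g y\<close> in the original one, and
  \<open>D\<close> commutes with \<open>g\<close>. The three traces therefore vanish along the whole
  orbit.\<close>

lemma tr_GL_act:
  assumes g: "g \<in> GL" and nil: "nilpotent_bracket \<mu>"
  shows "tr (GL_act g \<mu> y) = 0" "tr (\<lambda>z. GL_act g \<mu> y (GL_act g \<mu> y z)) = 0"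
    and "D \<in> Der \<mu> \<Longrightarrow> (\<And>x. g (D x) = D (g x)) \<Longrightarrow> tr (\<lambda>z. D (GL_act g \<mu> y z)) = 0"
proof -
  note i = GL_inv[OF g]
  note conj = tr_conjugate[OF i(3) linear_blinfun_apply[of g] _ i(2)]
  note lin = linear_blinfun_apply linear_compose[OF linear_blinfun_apply linear_blinfun_apply, unfolded o_def]
  let ?x = "inv g y"
  have "blinfun_apply (GL_act g \<mu> y) = (\<lambda>z. g (\<mu> ?x (inv g z)))"
    by (rule ext) (rule GL_act_apply[OF g])
  then show "tr (GL_act g \<mu> y) = 0"
    using conj[OF lin(1), of "\<mu> ?x"] tr_bracket_operators(1)[OF nil, of ?x] by simp
  show "tr (\<lambda>z. GL_act g \<mu> y (GL_act g \<mu> y z)) = 0"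
    using conj[OF lin(2), of "\<mu> ?x" "\<mu> ?x"] tr_bracket_operators(2)[OF nil, of ?x]
    by (simp add: GL_act_apply[OF g] i)
  assume D: "D \<in> Der \<mu>" and c: "\<And>x. g (D x) = D (g x)"
  show "tr (\<lambda>z. D (GL_act g \<mu> y z)) = 0"
    using conj[OF lin(2), of D "\<mu> ?x"] tr_bracket_operators(3)[OF nil D, of ?x]
    by (simp add: GL_act_apply[OF g] c)
qed

text \<open>The map \<open>T\<close>, which applies \<open>g\<close> on the ideal and stretches
  \<open>f\<close> by \<open>sqrt c\<close>, is an isometry onto the standard inner product. It
  changes the bracket to \<open>GL_act g \<mu>\<close>; as \<open>g\<close> commutes with
  \<open>D\<close>, normalizing \<open>f\<close> only divides \<open>D\<close> by
  \<open>sqrt c\<close>.\<close>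

lemma ricci_semidirect:
  fixes \<mu> :: "'a::euclidean_space \<Rightarrow>\<^sub>L 'a \<Rightarrow>\<^sub>L 'a"
  assumes sk: "\<mu> \<in> skew_maps" and nil: "nilpotent_bracket \<mu>" and D: "D \<in> Der \<mu>" "D \<in> sym_ops"
    and g: "g \<in> GL" and comm: "\<And>x. g (D x) = D (g x)" and c: "0 < c"
  shows "ricci (semidirect \<mu> D) (\<lambda>p q. c * fst p * fst q + g (snd p) \<bullet> g (snd q)) p p
    = ric_form (GL_act g \<mu>) (g (snd p)) - tr D / c * (D (g (snd p)) \<bullet> g (snd p))
      - (fst p)\<^sup>2 * tr (\<lambda>y. D (D y))"
proof -
  note i = GL_inv[OF g]
  define s where "s = sqrt c"
  have s: "0 < s" "s * s = c" using c by (auto simp: s_def)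
  define E where "E = (1 / s) *\<^sub>R D"
  define T where "T p = (s * fst p, g (snd p))" for p :: "real \<times> 'a"
  define S where "S p = (fst p / s, inv g (snd p))" for p :: "real \<times> 'a"
  let ?\<nu> = "GL_act g \<mu>"
  let ?N = "semidirect_connection ?\<nu> E"
  have sk': "?\<nu> \<in> skew_maps" by (rule GL_act_skew[OF g sk])
  have E: "E \<in> sym_ops" using D(2) by (simp add: E_def sym_ops_def blinfun.scaleR_left)
  have DD: "D (inv g x) = inv g (D x)" for x using comm i by metis
  have "ricci (semidirect \<mu> D) (\<lambda>p q. c * fst p * fst q + g (snd p) \<bullet> g (snd q)) p p
    = tr (\<lambda>z. ?N z (?N (T p) (T p)) - ?N (T p) (?N z (T p)) - ?N (semidirect ?\<nu> E z (T p)) (T p))"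
  proof (rule ricci_transport[where S = S])
    show "linear T" by (rule linearI) (auto simp: T_def blinfun.bilinear_simps algebra_simps)
    show "linear S" using i(3) by (auto simp: S_def linear_iff add_divide_distrib)
    show "T (S x) = x" "S (T x) = x" for x using s by (auto simp: T_def S_def i)
    show "bilinear (semidirect ?\<nu> E)" by (rule bilinear_semidirect)
    show "semidirect ?\<nu> E x y = - semidirect ?\<nu> E y x" for x y by (rule semidirect_skew[OF sk'])
    show "semidirect \<mu> D x y = S (semidirect ?\<nu> E (T x) (T y))" for x y
      using s by (simp add: semidirect_def S_def T_def E_def blinfun.scaleR_left GL_act_apply[OF g] i
          comm[symmetric] linear_add[OF i(3)] linear_diff[OF i(3)] linear_cmul[OF i(3)])
    show "c * fst x * fst y + g (snd x) \<bullet> g (snd y) = T x \<bullet> T y" for x y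
      using s by (simp add: T_def inner_prod_def)
    show "is_levi_civita (semidirect ?\<nu> E) (\<bullet>) ?N" by (rule is_levi_civita_semidirect[OF sk' E])
  qed
  also have "\<dots> = ric_form ?\<nu> (g (snd p)) - tr E * (E (g (snd p)) \<bullet> g (snd p))
      - (s * fst p)\<^sup>2 * tr (\<lambda>y. E (E y))"
    unfolding T_def
  proof (rule tr_semidirect_curvature[OF sk' E])
    show "tr (\<lambda>y. E (?\<nu> x y)) = 0" for x
      using tr_GL_act(3)[OF g nil D(1) comm] by (simp add: E_def blinfun.scaleR_left tr_cmul)
  qed (rule tr_GL_act[OF g nil])+
  also have "tr E = tr D / s" by (simp add: E_def blinfun.scaleR_left[abs_def] tr_cmul)
  also have "tr (\<lambda>y. E (E y)) = tr (\<lambda>y. D (D y)) / c"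
    using s tr_cmul[of "1 / c" "\<lambda>y. D (D y)"] by (simp add: E_def blinfun.scaleR_left blinfun.scaleR_right)
  also have "tr D / s * (E (g (snd p)) \<bullet> g (snd p)) = tr D / c * (D (g (snd p)) \<bullet> g (snd p))"
    by (simp add: E_def blinfun.scaleR_left s(2)[symmetric])
  also have "(s * fst p)\<^sup>2 * (tr (\<lambda>y. D (D y)) / c) = (fst p)\<^sup>2 * tr (\<lambda>y. D (D y))"
    using s(1) by (simp add: s(2)[symmetric] power2_eq_square)
  finally show ?thesis .
qed

text \<open>For symmetric \<open>D\<close> the trace is the sum of the squared norms of the images
  of the basis vectors. It makes the Ricci form negative in the direction of
  \<open>f\<close>.\<close>

lemma tr_square_pos:
  assumes D: "D \<in> sym_ops" and "tr D \<noteq> 0"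
  shows "0 < tr (\<lambda>y. D (D y))"
proof -
  have eq: "tr (\<lambda>y. D (D y)) = (\<Sum>b\<in>Basis. D b \<bullet> D b)"
  proof -
    have "D (D b) \<bullet> b = D b \<bullet> D b" for b
      using D unfolding sym_ops_def by blast
    then show ?thesis by (simp only: tr_def)
  qed
  obtain b where "b \<in> Basis" "D b \<noteq> 0"
  proof -
    have "tr D = 0" if "\<forall>b\<in>Basis. D b = 0"
      using that by (simp add: tr_def)
    then have "\<not> (\<forall>b\<in>Basis. D b = 0)" using assms(2) by blast
    then show thesis using that by blast
  qed
  then have "0 < (\<Sum>b\<in>Basis. D b \<bullet> D b)"
    by (intro sum_pos2[of _ b]) auto
  then show ?thesis by (simp add: eq)
qed

lemma ricci_negative_iff:
  fixes \<mu> :: "'a::euclidean_space \<Rightarrow>\<^sub>L 'a \<Rightarrow>\<^sub>L 'a"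
  assumes sk: "\<mu> \<in> skew_maps" and nil: "nilpotent_bracket \<mu>" and D: "D \<in> Der \<mu>" "D \<in> sym_ops"
    and tr: "0 < tr D"
  shows "ricci_negative \<mu> D \<longleftrightarrow>
    (\<exists>r>0. \<exists>\<nu>\<in>centralizer_orbit D \<mu>. \<forall>x. x \<noteq> 0 \<longrightarrow> r * ric_form \<nu> x < D x \<bullet> x)"
proof
  assume "ricci_negative \<mu> D"
  then obtain ip where ip: "inner_product_form ip"
    and ipD: "\<And>x y. ip (0, D x) (0, y) = ip (0, x) (0, D y)" and orth: "\<And>x. ip (1, 0) (0, x) = 0"
    and neg: "\<And>p. p \<noteq> 0 \<Longrightarrow> ricci (semidirect \<mu> D) ip p p < 0"
    unfolding ricci_negative_def by blast
  have bil: "bilinear ip" and ips: "\<And>x y. ip x y = ip y x" and pos: "\<And>x. x \<noteq> 0 \<Longrightarrow> 0 < ip x x"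
    using ip by (auto simp: inner_product_form_def)
  \<comment> \<open>\<open>P\<close> is the Gram operator of \<open>ip\<close> on the ideal. The
    symmetry of \<open>D\<close> for both inner products makes \<open>P\<close> commute with
    \<open>D\<close>, so its square root can be taken in the identity component of the
    centralizer.\<close>
  define P where "P = Blinfun (\<lambda>x. \<Sum>b\<in>Basis. ip (0, x) (0, b) *\<^sub>R b)"
  have lin: "linear (\<lambda>y. ip (0, x) (0, y))" "linear (\<lambda>y. ip (0, y) (0, x))" for x :: 'a
    using bilinear_radd[OF bil, of "(0, x)" "(0, _)" "(0, _)"] bilinear_rmul[OF bil, of "(0, x)" _ "(0, _)"]
      bilinear_ladd[OF bil, of "(0, _)" "(0, _)" "(0, x)"] bilinear_lmul[OF bil, of _ "(0, _)" "(0, x)"]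
    by (auto intro!: linearI)
  have P: "P x \<bullet> y = ip (0, x) (0, y)" for x y
  proof -
    have "linear (\<lambda>x. \<Sum>b\<in>Basis. ip (0, x) (0, b) *\<^sub>R b)"
      by (rule linearI) (simp_all add: linear_add[OF lin(2)] linear_cmul[OF lin(2)]
          scaleR_add_left sum.distrib scaleR_sum_right)
    then have "P x = (\<Sum>b\<in>Basis. ip (0, x) (0, b) *\<^sub>R b)"
      by (simp add: P_def bounded_linear_Blinfun_apply linear_conv_bounded_linear)
    then show ?thesis using linear_eq_inner_sum_Basis[OF lin(1)] by simp
  qed
  have symD: "D x \<bullet> y = x \<bullet> D y" for x y using D(2) by (auto simp: sym_ops_def)
  have symP: "P x \<bullet> y = x \<bullet> P y" for x y by (metis P inner_commute ips)
  have "P \<in> pos_ops" by (auto simp: pos_ops_def sym_ops_def symP) (simp add: symP[symmetric] P pos zero_prod_def)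
  moreover have "P o\<^sub>L D = D o\<^sub>L P"
    by (rule blinfun_eqI, rule vector_eq_rdot[THEN iffD1]) (simp add: P ipD symD)
  ultimately obtain g where g: "g \<in> centralizer_comp D" and gP: "\<And>x y. g x \<bullet> g y = P x \<bullet> y"
    using pos_op_as_square by blast
  note gG = centralizer_compD[OF g]
  define c where "c = ip (1, 0) (1, 0)"
  have c: "0 < c" by (simp add: c_def pos zero_prod_def)
  have "ip = (\<lambda>p q. c * fst p * fst q + g (snd p) \<bullet> g (snd q))"
  proof (intro ext)
    fix p q :: "real \<times> 'a"
    have split: "p = fst p *\<^sub>R (1, 0) + (0, snd p)" for p :: "real \<times> 'a" by (simp add: prod_eq_iff)
    have "ip (fst p *\<^sub>R (1, 0) + (0, snd p)) (fst q *\<^sub>R (1, 0) + (0, snd q))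
        = c * fst p * fst q + ip (0, snd p) (0, snd q)"
      unfolding bilinear_ladd[OF bil] bilinear_radd[OF bil] bilinear_lmul[OF bil] bilinear_rmul[OF bil]
      using orth ips[of "(0, snd p)" "(1, 0)"] by (simp add: c_def)
    then show "ip p q = c * fst p * fst q + g (snd p) \<bullet> g (snd q)"
      using split[of p] split[of q] by (simp add: gP P)
  qed
  note ric = ricci_semidirect[OF sk nil D gG c, folded this]
  have "c / tr D * ric_form (GL_act g \<mu>) x < D x \<bullet> x" if "x \<noteq> 0" for x
  proof -
    \<comment> \<open>At a vector of the ideal the term with the trace of the square of
      \<open>D\<close> is absent; \<open>inv g x\<close> is the vector that \<open>g\<close> carries
      to \<open>x\<close>.\<close>
    let ?y = "inv g x"
    have "g ?y = x" by (rule GL_inv[OF gG(1)])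
    moreover have "?y \<noteq> 0" using \<open>g ?y = x\<close> that by (metis blinfun.zero_right)
    then have "ricci (semidirect \<mu> D) ip (0, ?y) (0, ?y) < 0" by (intro neg) (simp add: zero_prod_def)
    ultimately have "ric_form (GL_act g \<mu>) x < tr D / c * (D x \<bullet> x)"
      using ric[of "(0, ?y)"] by simp
    then show ?thesis using tr c by (simp add: field_simps)
  qed
  moreover have "GL_act g \<mu> \<in> centralizer_orbit D \<mu>" using g by (simp add: centralizer_orbit_def)
  moreover have "0 < c / tr D" using c tr by simp
  ultimately show "\<exists>r>0. \<exists>\<nu>\<in>centralizer_orbit D \<mu>. \<forall>x. x \<noteq> 0 \<longrightarrow> r * ric_form \<nu> x < D x \<bullet> x"
    by blast
next
  assume "\<exists>r>0. \<exists>\<nu>\<in>centralizer_orbit D \<mu>. \<forall>x. x \<noteq> 0 \<longrightarrow> r * ric_form \<nu> x < D x \<bullet> x"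
  then obtain r g where r: "0 < r" and g: "g \<in> centralizer_comp D"
    and neg: "\<And>x. x \<noteq> 0 \<Longrightarrow> r * ric_form (GL_act g \<mu>) x < D x \<bullet> x"
    by (auto simp: centralizer_orbit_def)
  note gG = centralizer_compD[OF g]
  have g0: "g x = 0 \<longleftrightarrow> x = 0" for x
    by (metis GL_inv(2)[OF gG(1)] blinfun.zero_right)
  \<comment> \<open>With this squared length of \<open>f\<close> the factor \<open>tr D / c\<close>
    is \<open>1 / r\<close>, so the Ricci form on the ideal is the assumed negative difference
    divided by \<open>r\<close>.\<close>
  define c where "c = r * tr D"
  have c: "0 < c" using r tr by (simp add: c_def)
  define ip where "ip = (\<lambda>p q :: real \<times> 'a. c * fst p * fst q + g (snd p) \<bullet> g (snd q))"
  note ric = ricci_semidirect[OF sk nil D gG c, folded ip_def]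
  have symD: "D x \<bullet> y = x \<bullet> D y" for x y using D(2) by (auto simp: sym_ops_def)
  have "bilinear ip"
    by (auto simp: bilinear_def linear_iff ip_def blinfun.bilinear_simps inner_add algebra_simps)
  moreover have "0 < ip p p" if "p \<noteq> 0" for p
  proof -
    have "fst p \<noteq> 0 \<or> g (snd p) \<noteq> 0" using that by (auto simp: g0 prod_eq_iff)
    moreover have "0 < c * fst p * fst p" if "fst p \<noteq> 0"
      unfolding mult.assoc by (rule mult_pos_pos[OF c]) (use that not_real_square_gt_zero in blast)
    ultimately show ?thesis
      by (cases "fst p = 0") (auto simp: ip_def intro: add_pos_nonneg)
  qed
  ultimately have "inner_product_form ip"
    by (auto simp: inner_product_form_def ip_def inner_commute mult_ac)
  moreover have "ip (0, D x) (0, y) = ip (0, x) (0, D y)" for x y by (simp add: ip_def gG symD)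
  moreover have "ip (1, 0) (0, x) = 0" for x by (simp add: ip_def)
  moreover have "ricci (semidirect \<mu> D) ip p p < 0" if "p \<noteq> 0" for p
  proof -
    let ?x = "g (snd p)"
    have eq: "ricci (semidirect \<mu> D) ip p p
        = (r * ric_form (GL_act g \<mu>) ?x - D ?x \<bullet> ?x) / r - (fst p)\<^sup>2 * tr (\<lambda>y. D (D y))"
      using ric[of p] r tr by (simp add: c_def diff_divide_distrib)
    have t: "0 < tr (\<lambda>y. D (D y))" using tr by (intro tr_square_pos D) simp
    show ?thesis
    \<comment> \<open>On the line of \<open>f\<close> negativity comes from the trace of the square
      of \<open>D\<close>; off it the first summand is already negative.\<close>
    proof (cases "snd p = 0")
      case True
      then have "fst p \<noteq> 0" using that by (auto simp: prod_eq_iff)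
      with True t show ?thesis unfolding eq by (simp add: ric_form_def)
    next
      case False
      then have "(r * ric_form (GL_act g \<mu>) ?x - D ?x \<bullet> ?x) / r < 0"
        using neg[of ?x] r by (simp add: g0 divide_neg_pos)
      moreover have "0 \<le> (fst p)\<^sup>2 * tr (\<lambda>y. D (D y))" using t by simp
      ultimately show ?thesis unfolding eq by linarith
    qed
  qed
  ultimately show "ricci_negative \<mu> D"
    using D tr unfolding ricci_negative_def by blast
qed

section \<open>Rays through the moment image and the closure of the orbit\<close>

lemma ray_sum_moment_image_iff:
  assumes S: "S \<subseteq> skew_maps" and D: "D \<in> sym_ops"
  shows "D \<in> ray_sum (moment_image S) pos_ops \<longleftrightarrow>
    (\<exists>r>0. \<exists>\<nu>\<in>S - {0}. \<forall>x. x \<noteq> 0 \<longrightarrow> r * ric_form \<nu> x < D x \<bullet> x)"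
proof -
  \<comment> \<open>By \<open>moment_inner\<close>, positivity of this difference is the Ricci
    inequality with \<open>r\<close> rescaled by the positive factor
    \<open>2 / skew_inner \<nu> \<nu>\<close>.\<close>
  have mem: "D - r *\<^sub>R moment \<nu> \<in> pos_ops \<longleftrightarrow>
      (\<forall>x. x \<noteq> 0 \<longrightarrow> (2 * r / skew_inner \<nu> \<nu>) * ric_form \<nu> x < D x \<bullet> x)" if "\<nu> \<in> S" for r \<nu>
  proof -
    have "moment \<nu> \<in> sym_ops"
      using theI'[OF moment_ex1[of \<nu>]] by (simp add: moment_def is_moment_def)
    then have "D - r *\<^sub>R moment \<nu> \<in> sym_ops"
      using D by (auto simp: sym_ops_def blinfun.bilinear_simps inner_diff)
    then show ?thesis
      using that S
      by (simp add: pos_ops_def blinfun.bilinear_simps inner_diff_left moment_inner subset_iff mult_ac)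
  qed
  show ?thesis
  proof
    assume "D \<in> ray_sum (moment_image S) pos_ops"
    then obtain r \<nu> b where r: "0 < r" and \<nu>: "\<nu> \<in> S - {0}" and b: "b \<in> pos_ops" "D = r *\<^sub>R moment \<nu> + b"
      by (auto simp: ray_sum_def moment_image_def)
    then have "D - r *\<^sub>R moment \<nu> \<in> pos_ops" by simp
    then have "\<forall>x. x \<noteq> 0 \<longrightarrow> (2 * r / skew_inner \<nu> \<nu>) * ric_form \<nu> x < D x \<bullet> x"
      using mem \<nu> by blast
    moreover have "0 < 2 * r / skew_inner \<nu> \<nu>" using r \<nu> by (simp add: skew_inner_pos)
    ultimately show "\<exists>r>0. \<exists>\<nu>\<in>S - {0}. \<forall>x. x \<noteq> 0 \<longrightarrow> r * ric_form \<nu> x < D x \<bullet> x"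
      using \<nu> by blast
  next
    assume "\<exists>r>0. \<exists>\<nu>\<in>S - {0}. \<forall>x. x \<noteq> 0 \<longrightarrow> r * ric_form \<nu> x < D x \<bullet> x"
    then obtain r \<nu> where r: "0 < r" and \<nu>: "\<nu> \<in> S - {0}"
      and lt: "\<forall>x. x \<noteq> 0 \<longrightarrow> r * ric_form \<nu> x < D x \<bullet> x" by blast
    have n: "0 < skew_inner \<nu> \<nu>" using \<nu> by (simp add: skew_inner_pos)
    \<comment> \<open>Chosen to undo that rescaling.\<close>
    define r' where "r' = r * skew_inner \<nu> \<nu> / 2"
    have r': "0 < r'" "2 * r' / skew_inner \<nu> \<nu> = r" using r n by (auto simp: r'_def)
    have "D - r' *\<^sub>R moment \<nu> \<in> pos_ops"
      using mem[of \<nu> r'] \<nu> lt unfolding r' by blast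
    moreover have "D = r' *\<^sub>R moment \<nu> + (D - r' *\<^sub>R moment \<nu>)" by simp
    moreover have "moment \<nu> \<in> moment_image S" using \<nu> by (simp add: moment_image_def)
    ultimately show "D \<in> ray_sum (moment_image S) pos_ops"
      unfolding ray_sum_def using r'(1) by blast
  qed
qed

lemma ric_form_scaleR: "ric_form \<mu> (t *\<^sub>R x) = t\<^sup>2 * ric_form \<mu> x"
  by (simp add: ric_form_def blinfun.bilinear_simps power_mult_distrib sum_distrib_left
      right_diff_distrib power2_eq_square mult_ac)

text \<open>By homogeneity the inequality is only needed on the compact unit sphere, so it is an open condition on \<open>\<nu>\<close>.\<close>

lemma ric_form_less_closure:
  fixes D :: "'a::euclidean_space \<Rightarrow>\<^sub>L 'a"
  assumes \<nu>: "\<nu> \<in> closure S" and lt: "\<And>x. x \<noteq> 0 \<Longrightarrow> r * ric_form \<nu> x < D x \<bullet> x"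
  shows "\<exists>\<nu>\<in>S. \<forall>x. x \<noteq> 0 \<longrightarrow> r * ric_form \<nu> x < D x \<bullet> x"
proof -
  let ?W = "{p. r * ric_form (fst p) (snd p) < D (snd p) \<bullet> snd p}"
  have "open ?W"
    unfolding ric_form_def by (intro open_Collect_less continuous_intros) auto
  moreover have "{\<nu>} \<times> sphere 0 1 \<subseteq> ?W"
  proof (rule subsetI)
    fix p assume p: "p \<in> {\<nu>} \<times> sphere (0::'a) 1"
    then have "snd p \<noteq> 0" by auto
    then show "p \<in> ?W" using lt[of "snd p"] p by auto
  qed
  \<comment> \<open>By compactness of the sphere a single neighbourhood \<open>U\<close> of \<nu>
    serves all unit vectors at once; it meets \<open>S\<close> because \<nu> lies in the
    closure.\<close>
  ultimately have "\<exists>U. \<nu> \<in> U \<and> open U \<and> U \<times> sphere 0 1 \<subseteq> ?W"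
    by (rule Elementary_Topology.tube_lemma[OF compact_sphere])
  then obtain U where U: "\<nu> \<in> U" "open U" "U \<times> sphere 0 1 \<subseteq> ?W" by blast
  then obtain \<kappa> where \<kappa>: "\<kappa> \<in> S" "\<kappa> \<in> U"
    using \<nu> open_Int_closure_eq_empty[OF U(2), of S] by blast
  have "r * ric_form \<kappa> x < D x \<bullet> x" if "x \<noteq> 0" for x
  proof -
    let ?u = "x /\<^sub>R norm x"
    have "(\<kappa>, ?u) \<in> U \<times> sphere 0 1" using \<kappa> that by simp
    then have "(\<kappa>, ?u) \<in> ?W" by (rule subsetD[OF U(3)])
    then have "r * ric_form \<kappa> ?u < D ?u \<bullet> ?u" by (simp only: mem_Collect_eq fst_conv snd_conv)
    then have "(inverse (norm x))\<^sup>2 * (r * ric_form \<kappa> x) < (inverse (norm x))\<^sup>2 * (D x \<bullet> x)"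
      by (simp add: ric_form_scaleR blinfun.scaleR_right power2_eq_square mult_ac)
    then show ?thesis by (rule mult_left_less_imp_less) simp
  qed
  with \<kappa>(1) show ?thesis by blast
qed

text \<open>Removing 0 from the domain of the moment map thus leaves the orbit unchanged.\<close>

lemma centralizer_orbit_nonzero:
  assumes "\<mu> \<noteq> 0"
  shows "0 \<notin> centralizer_orbit D \<mu>"
proof
  assume "0 \<in> centralizer_orbit D \<mu>"
  then obtain g where g: "g \<in> GL" and 0: "GL_act g \<mu> = 0"
    by (auto simp: centralizer_orbit_def dest: centralizer_compD)
  have "\<mu> x y = 0" for x y
  proof -
    have "\<mu> x y = inv g (GL_act g \<mu> (g x) (g y))" by (simp add: GL_act_apply[OF g] GL_inv[OF g])
    then show ?thesis by (simp add: 0 linear_0[OF GL_inv(3)[OF g]])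
  qed
  then have "\<mu> = 0" by (intro blinfun_eqI) simp
  with assms show False by simp
qed

theorem theorem3p2:
  fixes br :: "'a::euclidean_space \<Rightarrow>\<^sub>L 'a \<Rightarrow>\<^sub>L 'a" and D :: "'a \<Rightarrow>\<^sub>L 'a"
  assumes "lie_bracket br" and "nilpotent_bracket br" and "\<exists>x y. br x y \<noteq> 0"
    and "D \<in> Der br \<inter> sym_ops" and "0 < tr D"
  shows "(ricci_negative br D \<longleftrightarrow>
            D \<in> ray_sum (moment_image (centralizer_orbit D br)) pos_ops) \<and>
         (ricci_negative br D \<longleftrightarrow>
            D \<in> ray_sum (moment_image (closure (centralizer_orbit D br))) pos_ops)"
proof -
  let ?O = "centralizer_orbit D br"
  have sk: "br \<in> skew_maps" using assms(1) by (simp add: lie_bracket_def)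
  have D: "D \<in> Der br" "D \<in> sym_ops" using assms(4) by auto
  have "br \<noteq> 0" using assms(3) by auto
  then have nz: "0 \<notin> ?O" by (rule centralizer_orbit_nonzero)
  have sub: "?O \<subseteq> skew_maps" by (rule centralizer_orbit_skew[OF sk])
  then have sub': "closure ?O \<subseteq> skew_maps" by (intro closure_minimal closed_skew_maps)
  have neg: "ricci_negative br D \<longleftrightarrow> (\<exists>r>0. \<exists>\<nu>\<in>?O. \<forall>x. x \<noteq> 0 \<longrightarrow> r * ric_form \<nu> x < D x \<bullet> x)"
    by (rule ricci_negative_iff[OF sk assms(2) D assms(5)])
  \<comment> \<open>The same \<open>r\<close> serves on both sides: a witness in the closure is
    replaced by a nearby one in the orbit, and a witness in the orbit is a nonzero element of the
    closure.\<close>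
  have "(\<exists>\<nu>\<in>?O. \<forall>x. x \<noteq> 0 \<longrightarrow> r * ric_form \<nu> x < D x \<bullet> x) \<longleftrightarrow>
      (\<exists>\<nu>\<in>closure ?O - {0}. \<forall>x. x \<noteq> 0 \<longrightarrow> r * ric_form \<nu> x < D x \<bullet> x)" for r
    using ric_form_less_closure[of _ ?O r D] nz closure_subset[of ?O] by blast
  moreover have "?O - {0} = ?O" using nz by blast
  ultimately show ?thesis
    unfolding neg ray_sum_moment_image_iff[OF sub D(2)] ray_sum_moment_image_iff[OF sub' D(2)]
    by simp
qed

end
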